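(* Let $q\geq 3$ be an integer and $p\in(0,1)$. For the switch-walk-switch lamplighter random walk $(Z_n)_{n\ge0}$ on $(\mathbb{Z}/2)\wr\mathcal{T}_q$ described in the context, the rate of escape $\ell=\lim_{n\to\infty}\ell(Z_n)/n$ satisfies $$\ell\ \geq\ \frac{q-2}{q}\,(1+B),\qquad\text{where } B=\frac{4}{q^3}(q-1)(q-2)\,p(1-p).$$
   Context: Let $\mathcal{S}=\{a_1,\dots,a_q\}$ and let $\mathcal{T}_q$ be the free product of $q$ copies of $\mathbb{Z}/2$ generated by the $a_i$ (so $a_i^{-1}=a_i$); its elements are the finite words over $\mathcal{S}$ with no two equal consecutive letters, the identity is the empty word $o$, and its Cayley graph with respect to $\mathcal{S}$ is the homogeneous tree of degree $q$. $\mathcal{N}$ is the set of finitely supported functions $\eta:\mathcal{T}_q\to\mathbb{Z}/2=\{0,1\}$ (lamp configurations), $\mathbf{0}$ is the zero function, $\mathbf{1}_A$ is the indicator function of $A\subseteq\mathcal{T}_q$, and $(x\eta)(w):=\eta(x^{-1}w)$. The group $\mathcal{L}_q=(\mathbb{Z}/2)\wr\mathcal{T}_q$ is the set $\mathcal{N}\times\mathcal{T}_q$ with the product $(\eta_1,x)(\eta_2,y)=(\eta_1\oplus x\eta_2,\,xy)$, where $\oplus$ is pointwise addition mod 2; its identity is $(\mathbf{0},o)$. Switch-walk-switch random walk: let $\mathcal{S}^*_{\mathcal{L}_q}=\{(\mathbf{1}_A,a): a\in\mathcal{S},\ A\in\{\emptyset,\{o\},\{a\},\{o,a\}\}\}$,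 and let $\mu^*$ be the probability measure on $\mathcal{S}^*_{\mathcal{L}_q}$ with $\mu^*((\mathbf{1}_A,a))=(1-p)^2/q$ if $A=\emptyset$, $=p(1-p)/q$ if $|A|=1$, and $=p^2/q$ if $|A|=2$. Then $Z_0=(\mathbf{0},o)$ and $Z_n=Z_{n-1}\mathbf{i}_n$, where $\mathbf{i}_1,\mathbf{i}_2,\dots$ are i.i.d. with law $\mu^*$. Here $\ell(g)$, for $g\in\mathcal{L}_q$, is the graph distance of $g$ to $(\mathbf{0},o)$ in the Cayley graph of $\mathcal{L}_q$ with respect to $\mathcal{S}^*_{\mathcal{L}_q}$ (edges $g\sim gs$). The limit $\ell=\lim_{n\to\infty}\ell(Z_n)/n$ exists almost surely and is almost surely constant (Kingman's subadditive ergodic theorem). *)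

theory Defs
  imports "HOL-Probability.Probability" "HOL-Algebra.Group" "HOL-Library.Z2"
begin

text \<open>
  The letters \<open>a\<^sub>1, \<dots>, a\<^sub>q\<close> are encoded as the numbers \<open>0, \<dots>, q - 1\<close>, and the elements of the
  free product of \<open>q\<close> copies of \<open>\<int>/2\<close> as reduced words over them. Multiplying a reduced
  word from the left by a letter either adds the letter or cancels it.
\<close>

fun letter_mult :: "nat \<Rightarrow> nat list \<Rightarrow> nat list" where
  "letter_mult a [] = [a]"
| "letter_mult a (b # w) = (if a = b then w else a # b # w)"

definition tree_group :: "nat \<Rightarrow> nat list monoid" where
  "tree_group q =
    \<lparr>carrier = {w. set w \<subseteq> {..<q} \<and> distinct_adj w},
     monoid.mult = (\<lambda>x y. foldr letter_mult x y),
     one = []\<rparr>"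

definition lamps_on :: "('a \<Rightarrow> bit) \<Rightarrow> 'a set" where
  "lamps_on \<eta> = {w. \<eta> w \<noteq> 0}"

text \<open>Configurations live on all lists but vanish outside the reduced words.\<close>

definition configurations :: "nat \<Rightarrow> (nat list \<Rightarrow> bit) set" where
  "configurations q = {\<eta>. finite (lamps_on \<eta>) \<and> lamps_on \<eta> \<subseteq> carrier (tree_group q)}"

definition translate :: "nat \<Rightarrow> nat list \<Rightarrow> (nat list \<Rightarrow> bit) \<Rightarrow> nat list \<Rightarrow> bit" where
  "translate q x \<eta> w =
    (if w \<in> carrier (tree_group q)
     then \<eta> (inv\<^bsub>tree_group q\<^esub> x \<otimes>\<^bsub>tree_group q\<^esub> w) else 0)"

type_synonym lamplighter = "(nat list \<Rightarrow> bit) \<times> nat list"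

definition lamplighter_group :: "nat \<Rightarrow> lamplighter monoid" where
  "lamplighter_group q =
    \<lparr>carrier = configurations q \<times> carrier (tree_group q),
     monoid.mult = (\<lambda>(\<eta>\<^sub>1, x) (\<eta>\<^sub>2, y).
       (\<lambda>w. \<eta>\<^sub>1 w + translate q x \<eta>\<^sub>2 w, x \<otimes>\<^bsub>tree_group q\<^esub> y)),
     one = (\<lambda>w. 0, \<one>\<^bsub>tree_group q\<^esub>)\<rparr>"

definition sws_generators :: "nat \<Rightarrow> lamplighter set" where
  "sws_generators q =
    {(indicator A, [a]) | A a. a < q \<and> A \<in> {{}, {[]}, {[a]}, {[], [a]}}}"

text \<open>The point masses of \<open>\<mu>\<^sup>*\<close>, extended by zero outside the generators.\<close>

definition sws_weight :: "nat \<Rightarrow> real \<Rightarrow> lamplighter \<Rightarrow> real" where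
  "sws_weight q p g =
    (if g \<in> sws_generators q then
       (let k = card (lamps_on (fst g)) in
        if k = 0 then (1 - p)\<^sup>2 / real q
        else if k = 1 then p * (1 - p) / real q
        else p\<^sup>2 / real q)
     else 0)"

definition cayley_edges :: "('a, 'b) monoid_scheme \<Rightarrow> 'a set \<Rightarrow> ('a \<times> 'a) set" where
  "cayley_edges G S =
    {(g, h). g \<in> carrier G \<and> h \<in> carrier G \<and>
       (\<exists>s\<in>S. h = g \<otimes>\<^bsub>G\<^esub> s \<or> g = h \<otimes>\<^bsub>G\<^esub> s)}"

text \<open>Meaningful when \<open>g\<close> and \<open>h\<close> are joined by a path, as they always are when \<open>S\<close> generates \<open>G\<close>.\<close>

definition cayley_dist :: "('a, 'b) monoid_scheme \<Rightarrow> 'a set \<Rightarrow> 'a \<Rightarrow> 'a \<Rightarrow> nat" where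
  "cayley_dist G S g h = (LEAST n. (g, h) \<in> cayley_edges G S ^^ n)"

definition sws_length :: "nat \<Rightarrow> lamplighter \<Rightarrow> nat" where
  "sws_length q g =
    cayley_dist (lamplighter_group q) (sws_generators q) g \<one>\<^bsub>lamplighter_group q\<^esub>"

text \<open>The increments are indexed from 1; \<open>i 0\<close> is never used.\<close>

primrec walk :: "('a, 'b) monoid_scheme \<Rightarrow> (nat \<Rightarrow> 'm \<Rightarrow> 'a) \<Rightarrow> nat \<Rightarrow> 'm \<Rightarrow> 'a" where
  "walk G i 0 \<omega> = \<one>\<^bsub>G\<^esub>"
| "walk G i (Suc n) \<omega> = walk G i n \<omega> \<otimes>\<^bsub>G\<^esub> i (Suc n) \<omega>"

end

theory Submission
  imports Defs "HOL-Library.Sublist"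
begin

text \<open>
  The existence of the limit is Kingman's theorem for an i.i.d. sequence. For words in i.i.d.
  letters and a subadditive functional \<open>f\<close> with \<open>0 \<le> f \<le> length\<close> that changes by at most \<open>k\<close> when the
  first \<open>k\<close> letters are dropped, it has a short proof. Write \<open>\<lambda>\<close> for the infimum over \<open>n \<ge> 1\<close> of the
  mean of \<open>f\<close> over words of length \<open>n\<close>, divided by \<open>n\<close>. Cutting a long word into blocks of fixed length
  and applying Hoeffding's inequality to the independent blocks gives \<open>limsup \<le> \<lambda>\<close>
  (\<open>eventually_le_mean\<close>). For the other bound, \<open>liminf \<le> a\<close> is a tail event. If it had probability 1
  for some \<open>a < \<lambda>\<close>, then most positions would begin a stretch of bounded length along which \<open>f\<close> has slope
  less than \<open>\<lambda>\<close>; tiling a long word by such stretches would push the mean below \<open>n\<lambda>\<close>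
  (\<open>tiling\<close>). By Kolmogorov's 0-1 law it therefore has probability 0 (\<open>not_slow\<close>). Word length in a
  Cayley graph is such a functional.

  The limit is also the limit of the mean length divided by \<open>n\<close>, so only means need a lower bound.
  A path from \<open>(\<eta>, x)\<close> to the identity projects to a walk in the tree that joins \<open>x\<close> to the root and
  visits every lit vertex. It crosses every edge of the spanned subtree, and those off the geodesic from
  the root to \<open>x\<close> at least twice (\<open>excursion_length_le_path\<close>). Therefore the length is at least \<open>|x|\<close>
  plus twice the number of vertices of the geodesic before \<open>x\<close> that have a lit child off the geodesic.

  The distance \<open>|x|\<close> grows by at least \<open>(q - 2) / q\<close> per step on average. To count the side lamps,
  weight a geodesic vertex with a side lamp at distance \<open>r\<close> behind the walker by
  \<open>1 - (q - 1)\<^sup>-\<^sup>r\<close>, the probability of never returning to that vertex. This weight is harmonic along the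
  walk, so on average the weighted count (\<open>branch_potential\<close>) changes only by new contributions: when
  the walker leaves a vertex that has a lit child \<open>c\<close> through a different child, the count gains
  \<open>(q - 2) / (q - 1)\<close>. A lit child is provided by a step outwards and back: the two steps flip the lamp at the child an odd number
  of times with probability \<open>2p(1 - p)\<close>, so it is lit afterwards with at least this probability,
  whatever its state was. Altogether the weighted count grows on average by at least
  \<open>2p(1 - p)(q - 2)\<^sup>2 / q\<^sup>3\<close> per step, and twice this is at least \<open>B(q - 2) / q\<close>.
\<close>

section \<open>Words in independent letters\<close>

definition word :: "(nat \<Rightarrow> 'm \<Rightarrow> 'a) \<Rightarrow> nat \<Rightarrow> nat \<Rightarrow> 'm \<Rightarrow> 'a list" where
  "word X m n \<omega> = map (\<lambda>k. X k \<omega>) [m..<n]"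

lemma word_self [simp]: "word X m m \<omega> = []"
  by (simp add: word_def)

lemma length_word [simp]: "length (word X m n \<omega>) = n - m"
  by (simp add: word_def)

lemma word_append: "m \<le> k \<Longrightarrow> k \<le> n \<Longrightarrow> word X m n \<omega> = word X m k \<omega> @ word X k n \<omega>"
  using upt_add_eq_append[of m k "n - k"] by (simp add: word_def)

lemma take_word: "j \<le> n \<Longrightarrow> take j (word X m (m + n) \<omega>) = word X m (m + j) \<omega>"
  by (simp add: word_def take_map)

lemma set_word: "(\<And>k. X k \<omega> \<in> S) \<Longrightarrow> set (word X m n \<omega>) \<subseteq> S"
  by (auto simp: word_def)

lemma measurable_word:
  assumes S: "finite S" and X: "\<And>k. m \<le> k \<Longrightarrow> X k \<in> measurable N (count_space S)"
  shows "word X m n \<in> measurable N (count_space (lists S))"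
proof -
  have "countable (lists S)"
    using S by (simp add: countable_finite)
  moreover have "word X m n -` {ws} \<inter> space N \<in> sets N" if ws: "ws \<in> lists S" for ws
  proof (cases "length ws = n - m")
    case True
    have "word X m n -` {ws} \<inter> space N = {\<omega> \<in> space N. \<forall>k\<in>{m..<n}. X k \<omega> = ws ! (k - m)}"
    proof (rule Set.set_eqI)
      fix \<omega>
      have "word X m n \<omega> = ws \<longleftrightarrow> (\<forall>j<n - m. X (m + j) \<omega> = ws ! j)"
        using True by (auto simp: word_def list_eq_iff_nth_eq)
      also have "\<dots> \<longleftrightarrow> (\<forall>k\<in>{m..<n}. X k \<omega> = ws ! (k - m))"
        by (auto simp: Ball_def) (metis add_diff_inverse_nat diff_less_mono leD)
      finally show "\<omega> \<in> word X m n -` {ws} \<inter> space N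
          \<longleftrightarrow> \<omega> \<in> {\<omega> \<in> space N. \<forall>k\<in>{m..<n}. X k \<omega> = ws ! (k - m)}"
        by auto
    qed
    also have "\<dots> \<in> sets N"
    proof (rule sets.sets_Collect_finite_All)
      fix k assume k: "k \<in> {m..<n}"
      have "ws ! (k - m) \<in> S"
        using ws True k by auto
      then have "X k -` {ws ! (k - m)} \<inter> space N \<in> sets N"
        using X[of k] k by (intro measurable_sets[where A="count_space S"]) auto
      then show "{\<omega> \<in> space N. X k \<omega> = ws ! (k - m)} \<in> sets N"
        by (simp add: vimage_def Int_def conj_commute)
    qed simp
    finally show ?thesis .
  next
    case False
    then have "word X m n -` {ws} \<inter> space N = {}"
      by auto
    then show ?thesis by simp
  qed
  moreover have "word X m n \<in> space N \<rightarrow> lists S"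
    using measurable_space[OF X] by (auto simp: word_def)
  ultimately show ?thesis
    by (subst measurable_count_space_eq_countable) auto
qed

definition words :: "'a set \<Rightarrow> nat \<Rightarrow> 'a list set" where
  "words S n = {ws. set ws \<subseteq> S \<and> length ws = n}"

text \<open>
  The expectation of \<open>F\<close> at a word of \<open>n\<close> independent letters with weights \<open>w\<close>. A finite sum makes
  it evident that the position of a word in the sequence of letters does not affect its law.
\<close>

definition word_mean :: "'a set \<Rightarrow> ('a \<Rightarrow> real) \<Rightarrow> nat \<Rightarrow> ('a list \<Rightarrow> real) \<Rightarrow> real" where
  "word_mean S w n F = (\<Sum>ws\<in>words S n. prod_list (map w ws) * F ws)"

lemma word_mean_0 [simp]: "word_mean S w 0 F = F []"
proof -
  have "words S 0 = {[]}"
    by (auto simp: words_def)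
  then show ?thesis
    by (simp add: word_mean_def)
qed

text \<open>
  Averaging over the last letter first is what turns means along a random walk into iterates of its
  one-step averaging operator.
\<close>

lemma word_mean_Suc:
  assumes "finite S"
  shows "word_mean S w (Suc n) F = word_mean S w n (\<lambda>ws. \<Sum>s\<in>S. w s * F (ws @ [s]))"
proof -
  have "words S (Suc n) = (\<lambda>(ws, s). ws @ [s]) ` (words S n \<times> S)"
  proof (intro equalityI subsetI)
    fix vs assume vs: "vs \<in> words S (Suc n)"
    then have "vs = butlast vs @ [last vs]"
      by (auto simp: words_def intro!: append_butlast_last_id[symmetric])
    moreover have "butlast vs \<in> words S n" "last vs \<in> S"
      using vs by (auto simp: words_def dest: in_set_butlastD) (metis last_in_set length_0_conv nat.distinct(1) subsetD)
    ultimately show "vs \<in> (\<lambda>(ws, s). ws @ [s]) ` (words S n \<times> S)"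
      by (intro image_eqI[of _ _ "(butlast vs, last vs)"]) auto
  qed (auto simp: words_def)
  moreover have "inj_on (\<lambda>(ws, s). ws @ [s]) (words S n \<times> S)"
    by (auto simp: inj_on_def)
  ultimately have "word_mean S w (Suc n) F =
      (\<Sum>(ws, s)\<in>words S n \<times> S. prod_list (map w (ws @ [s])) * F (ws @ [s]))"
    unfolding word_mean_def by (simp add: sum.reindex case_prod_unfold)
  also have "\<dots> = word_mean S w n (\<lambda>ws. \<Sum>s\<in>S. w s * F (ws @ [s]))"
    by (simp add: word_mean_def sum.cartesian_product[symmetric] sum_distrib_left mult.assoc)
  finally show ?thesis .
qed

lemma word_mean_mono:
  assumes "\<And>s. s \<in> S \<Longrightarrow> 0 \<le> w s" and "\<And>ws. set ws \<subseteq> S \<Longrightarrow> F ws \<le> H ws"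
  shows "word_mean S w n F \<le> word_mean S w n H"
  unfolding word_mean_def
proof (rule sum_mono)
  fix ws assume ws: "ws \<in> words S n"
  then have "0 \<le> prod_list (map w ws)"
    using assms(1) by (intro prod_list_nonneg) (auto simp: words_def)
  then show "prod_list (map w ws) * F ws \<le> prod_list (map w ws) * H ws"
    using ws assms(2) by (intro mult_left_mono) (auto simp: words_def)
qed

lemma word_mean_add: "word_mean S w n (\<lambda>ws. F ws + H ws) = word_mean S w n F + word_mean S w n H"
  by (simp add: word_mean_def distrib_left sum.distrib)

lemma word_mean_cmult: "word_mean S w n (\<lambda>ws. c * F ws) = c * word_mean S w n F"
  by (simp add: word_mean_def sum_distrib_left mult.left_commute)

lemma word_mean_const:
  assumes "finite S" "sum w S = 1"
  shows "word_mean S w n (\<lambda>_. c) = c"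
proof (induction n)
  case (Suc n)
  then show ?case
    using assms by (simp add: word_mean_Suc sum_distrib_right[symmetric])
qed simp

lemma (in prob_space) indep_vars_Suc:
  assumes "indep_vars (\<lambda>_. N) X {1..}"
  shows "indep_vars (\<lambda>_. N) (\<lambda>k. X (Suc k)) UNIV"
proof -
  let ?F = "\<lambda>k. {X k -` A \<inter> space M |A. A \<in> sets N}"
  have rv: "\<And>k. 1 \<le> k \<Longrightarrow> random_variable N (X k)" and ind: "indep_sets ?F {1..}"
    using assms by (auto simp: indep_vars_def2)
  have "indep_sets (\<lambda>k. ?F (Suc k)) UNIV"
  proof (rule indep_setsI)
    show "?F (Suc k) \<subseteq> events" for k
      using rv[of "Suc k"] by (auto simp: measurable_def)
    fix A J assume J: "J \<noteq> {}" "finite (J :: nat set)" and A: "\<forall>j\<in>J. A j \<in> ?F (Suc j)"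
    have "prob (\<Inter>j\<in>Suc ` J. A (j - 1)) = (\<Prod>j\<in>Suc ` J. prob (A (j - 1)))"
      using J A by (intro indep_setsD[OF ind]) auto
    then show "prob (\<Inter>j\<in>J. A j) = (\<Prod>j\<in>J. prob (A j))"
      by (simp add: prod.reindex)
  qed
  then show ?thesis
    using rv by (simp add: indep_vars_def2)
qed

locale iid_letters = prob_space +
  fixes S :: "'b set" and X :: "nat \<Rightarrow> 'a \<Rightarrow> 'b" and w :: "'b \<Rightarrow> real"
  assumes finite_S: "finite S"
    and indep: "indep_vars (\<lambda>_. count_space S) X UNIV"
    and law: "\<And>n s. s \<in> S \<Longrightarrow> prob {\<omega> \<in> space M. X n \<omega> = s} = w s"
begin

lemma X_measurable [measurable]: "X n \<in> measurable M (count_space S)"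
  using indep by (simp add: indep_vars_def)

lemma word_measurable [measurable]: "word X m n \<in> measurable M (count_space (lists S))"
  using finite_S by (intro measurable_word) auto

lemma X_in: "\<omega> \<in> space M \<Longrightarrow> X n \<omega> \<in> S"
  using X_measurable[of n] by (auto simp: measurable_def)

lemma word_in: "\<omega> \<in> space M \<Longrightarrow> set (word X m n \<omega>) \<subseteq> S"
  by (intro set_word X_in)

lemma borel_measurable_word [measurable]: "(\<lambda>\<omega>. F (word X m n \<omega>)) \<in> borel_measurable M"
  by (rule measurable_compose[OF word_measurable]) auto

lemma prob_word:
  assumes ws: "ws \<in> words S n"
  shows "prob {\<omega> \<in> space M. word X m (m + n) \<omega> = ws} = prod_list (map w ws)"
proof (cases "n = 0")
  case True
  then show ?thesis
    using ws by (simp add: words_def prob_space)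
next
  case False
  have eq: "{\<omega> \<in> space M. word X m (m + n) \<omega> = ws}
      = (\<Inter>k\<in>{m..<m + n}. X k -` {ws ! (k - m)} \<inter> space M)"
  proof (rule Set.set_eqI)
    fix \<omega>
    have "word X m (m + n) \<omega> = ws \<longleftrightarrow> (\<forall>j<n. X (m + j) \<omega> = ws ! j)"
      using ws by (auto simp: word_def words_def list_eq_iff_nth_eq)
    also have "\<dots> \<longleftrightarrow> (\<forall>k\<in>{m..<m + n}. X k \<omega> = ws ! (k - m))"
      by (auto simp: Ball_def) (metis add_diff_inverse_nat less_diff_conv2 add.commute not_less)
    finally show "\<omega> \<in> {\<omega> \<in> space M. word X m (m + n) \<omega> = ws}
        \<longleftrightarrow> \<omega> \<in> (\<Inter>k\<in>{m..<m + n}. X k -` {ws ! (k - m)} \<inter> space M)"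
      using False by auto
  qed
  have inS: "ws ! (k - m) \<in> S" if "k \<in> {m..<m + n}" for k
    using ws that by (auto simp: words_def subset_eq)
  have "prob (\<Inter>k\<in>{m..<m + n}. X k -` {ws ! (k - m)} \<inter> space M)
      = (\<Prod>k\<in>{m..<m + n}. prob (X k -` {ws ! (k - m)} \<inter> space M))"
    using False inS by (intro indep_varsD[OF indep]) auto
  also have "\<dots> = (\<Prod>k\<in>{m..<m + n}. w (ws ! (k - m)))"
    using law inS by (intro prod.cong refl) (simp add: vimage_def Int_def conj_commute)
  also have "\<dots> = (\<Prod>j\<in>{0..<n}. w (ws ! j))"
    using prod.shift_bounds_nat_ivl[of "\<lambda>k. w (ws ! (k - m))" 0 m n] by (simp add: add.commute)
  also have "\<dots> = prod_list (map w ws)"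
    using ws by (simp add: prod.list_conv_set_nth words_def)
  finally show ?thesis
    by (simp add: eq)
qed

lemma expectation_word: "expectation (\<lambda>\<omega>. F (word X m (m + n) \<omega>)) = word_mean S w n F"
proof -
  have "expectation (\<lambda>\<omega>. F (word X m (m + n) \<omega>)) =
      expectation (\<lambda>\<omega>. \<Sum>ws\<in>words S n. F ws * indicator {\<omega> \<in> space M. word X m (m + n) \<omega> = ws} \<omega>)"
  proof (rule Bochner_Integration.integral_cong)
    fix \<omega> assume \<omega>: "\<omega> \<in> space M"
    have "(\<Sum>ws\<in>words S n. F ws * indicator {\<omega> \<in> space M. word X m (m + n) \<omega> = ws} \<omega>)
        = (\<Sum>ws\<in>words S n. if word X m (m + n) \<omega> = ws then F ws else 0)"
      using \<omega> by (intro sum.cong) (auto simp: indicator_def)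
    also have "\<dots> = F (word X m (m + n) \<omega>)"
      using word_in[OF \<omega>] finite_S by (subst sum.delta') (auto simp: words_def finite_lists_length_eq)
    finally show "F (word X m (m + n) \<omega>)
        = (\<Sum>ws\<in>words S n. F ws * indicator {\<omega> \<in> space M. word X m (m + n) \<omega> = ws} \<omega>)" ..
  qed simp
  also have "\<dots> = (\<Sum>ws\<in>words S n. F ws * prob {\<omega> \<in> space M. word X m (m + n) \<omega> = ws})"
  proof -
    have m: "{\<omega> \<in> space M. word X m (m + n) \<omega> = ws} \<in> events" if "ws \<in> words S n" for ws
    proof -
      have "word X m (m + n) -` {ws} \<inter> space M \<in> events"
        using that by (intro measurable_sets[OF word_measurable]) (auto simp: words_def)
      then show ?thesis by (simp add: vimage_def Int_def conj_commute)
    qed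
    show ?thesis
      by (subst Bochner_Integration.integral_sum) (auto simp: m less_top[symmetric])
  qed
  also have "\<dots> = word_mean S w n F"
    unfolding word_mean_def by (intro sum.cong) (auto simp: prob_word)
  finally show ?thesis .
qed

lemma prob_word_pred:
  "prob {\<omega> \<in> space M. Q (word X m (m + n) \<omega>)} = word_mean S w n (\<lambda>ws. of_bool (Q ws))"
proof -
  have [measurable]: "{\<omega> \<in> space M. Q (word X m (m + n) \<omega>)} \<in> events"
  proof -
    have "word X m (m + n) -` {ws \<in> lists S. Q ws} \<inter> space M \<in> events"
      by (intro measurable_sets[OF word_measurable]) auto
    moreover have "word X m (m + n) -` {ws \<in> lists S. Q ws} \<inter> space M = {\<omega> \<in> space M. Q (word X m (m + n) \<omega>)}"
      using word_in by fastforce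
    ultimately show ?thesis by simp
  qed
  have "prob {\<omega> \<in> space M. Q (word X m (m + n) \<omega>)}
      = expectation (indicator {\<omega> \<in> space M. Q (word X m (m + n) \<omega>)})"
    by simp
  also have "\<dots> = expectation (\<lambda>\<omega>. of_bool (Q (word X m (m + n) \<omega>)))"
    by (intro Bochner_Integration.integral_cong) (auto simp: indicator_def)
  finally show ?thesis
    by (simp only: expectation_word[of "\<lambda>ws. of_bool (Q ws)"])
qed

end

section \<open>Kingman's theorem for words\<close>

text \<open>
  The hypothesis \<open>suffix\<close> bounds the effect of deleting a prefix from the other side; it holds for word
  length in a group since a prefix can be cancelled by its inverse, and it makes the growth rate
  insensitive to the first letters.
\<close>

locale subadditive_words = iid_letters +
  fixes f :: "'b list \<Rightarrow> real"
  assumes subadd: "\<And>xs ys. set xs \<subseteq> S \<Longrightarrow> set ys \<subseteq> S \<Longrightarrow> f (xs @ ys) \<le> f xs + f ys"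
    and nonneg: "\<And>xs. set xs \<subseteq> S \<Longrightarrow> 0 \<le> f xs"
    and bound: "\<And>xs. set xs \<subseteq> S \<Longrightarrow> f xs \<le> length xs"
    and suffix: "\<And>xs ys. set xs \<subseteq> S \<Longrightarrow> set ys \<subseteq> S \<Longrightarrow> f ys \<le> length xs + f (xs @ ys)"
begin

definition mean_length :: "nat \<Rightarrow> real" where
  "mean_length n = word_mean S w n f"

definition rate :: real where
  "rate = (INF n\<in>{1..}. mean_length n / real n)"

lemma mean_length_eq: "mean_length n = expectation (\<lambda>\<omega>. f (word X m (m + n) \<omega>))"
  by (simp add: mean_length_def expectation_word)

lemma integrable_f [simp]: "integrable M (\<lambda>\<omega>. f (word X m n \<omega>))"
proof (rule integrable_const_bound)
  show "AE \<omega> in M. norm (f (word X m n \<omega>)) \<le> real (n - m)"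
    using bound nonneg word_in by (intro AE_I2) (fastforce simp: abs_le_iff)
qed simp

lemma mean_length_nonneg: "0 \<le> mean_length n"
  unfolding mean_length_eq[of n 0] using nonneg word_in
  by (intro Bochner_Integration.integral_nonneg_AE AE_I2) auto

lemma rate_le: "1 \<le> n \<Longrightarrow> rate \<le> mean_length n / n"
  unfolding rate_def using mean_length_nonneg
  by (intro cINF_lower bdd_belowI2[where m=0]) auto

lemma rate_less: "rate < a \<Longrightarrow> \<exists>n\<ge>1. mean_length n / n < a"
  unfolding rate_def using mean_length_nonneg
  by (subst (asm) cINF_less_iff) (auto intro!: bdd_belowI2[where m=0])

text \<open>
  A position \<open>k\<close> is bad if none of the words of length at most \<open>N\<close> that start there has slope at
  most \<open>b\<close>. Going through the word from the left, a bad letter is skipped at a cost of at most 1, and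
  from any other position a stretch of slope at most \<open>b\<close> is removed. When no such stretch fits,
  fewer than \<open>N\<close> letters are left.
\<close>

lemma tiling:
  assumes \<omega>: "\<omega> \<in> space M" and b: "0 \<le> b" and mn: "m \<le> n"
  shows "f (word X m n \<omega>) \<le> b * real (n - m) +
    (\<Sum>k\<in>{m..<n}. of_bool (\<forall>j\<in>{1..N}. b * real j < f (word X k (k + j) \<omega>))) + real N"
  using mn
proof (induction "n - m" arbitrary: m rule: less_induct)
  case less
  let ?bad = "\<lambda>k. \<forall>j\<in>{1..N}. b * real j < f (word X k (k + j) \<omega>)"
  have W: "set (word X k l \<omega>) \<subseteq> S" for k l
    using \<omega> by (rule word_in)
  show ?case
  proof (cases "m = n")
    case True
    then show ?thesis
      using bound[of "[]"] by simp
  next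
    case False
    with less.prems have mn: "m < n" by simp
    show ?thesis
    proof (cases "?bad m")
      case True
      have "f (word X m n \<omega>) \<le> f (word X m (Suc m) \<omega>) + f (word X (Suc m) n \<omega>)"
        using mn W by (subst word_append[of m "Suc m"]) (auto intro: subadd)
      also have "f (word X m (Suc m) \<omega>) \<le> 1"
        using bound[OF W[of m "Suc m"]] by simp
      also have "f (word X (Suc m) n \<omega>) \<le>
          b * real (n - Suc m) + (\<Sum>k\<in>{Suc m..<n}. of_bool (?bad k)) + real N"
        using mn by (intro less.hyps) auto
      also have "b * real (n - Suc m) \<le> b * real (n - m)"
        using b by (intro mult_left_mono) auto
      finally have "f (word X m n \<omega>) \<le>
          1 + (b * real (n - m) + (\<Sum>k\<in>{Suc m..<n}. of_bool (?bad k)) + real N)"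
        by simp
      moreover have "(\<Sum>k\<in>{m..<n}. of_bool (?bad k) :: real) = 1 + (\<Sum>k\<in>{Suc m..<n}. of_bool (?bad k))"
        by (subst sum.atLeast_Suc_lessThan[OF mn]) (use True in auto)
      ultimately show ?thesis
        by linarith
    next
      case False
      then obtain j where j: "j \<in> {1..N}" "f (word X m (m + j) \<omega>) \<le> b * real j"
        by (auto simp: not_less)
      have pos: "0 \<le> (\<Sum>k\<in>{m..<n}. of_bool (?bad k) :: real)"
        by (intro sum_nonneg) auto
      show ?thesis
      proof (cases "m + j \<le> n")
        case True
        have "f (word X m n \<omega>) \<le> f (word X m (m + j) \<omega>) + f (word X (m + j) n \<omega>)"
          using True W by (subst word_append[of m "m + j"]) (auto intro: subadd)
        also have "f (word X (m + j) n \<omega>) \<le>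
            b * real (n - (m + j)) + (\<Sum>k\<in>{m + j..<n}. of_bool (?bad k)) + real N"
          using True j mn by (intro less.hyps) auto
        also have "(\<Sum>k\<in>{m + j..<n}. of_bool (?bad k) :: real) \<le> (\<Sum>k\<in>{m..<n}. of_bool (?bad k))"
          by (intro sum_mono2) auto
        finally show ?thesis
          using j(2) True by (simp add: of_nat_diff algebra_simps)
      next
        case False
        have "f (word X m n \<omega>) \<le> real (n - m)"
          using bound[OF W] by (metis length_word)
        also have "\<dots> \<le> real N"
          using False j by auto
        finally show ?thesis
          using b pos by (smt (verit) mult_nonneg_nonneg of_nat_0_le_iff)
      qed
    qed
  qed
qed

text \<open>
  This says that the lower limit of \<open>f (word X k n \<omega>) / n\<close> is at most \<open>a\<close>.
\<close>

definition slow :: "nat \<Rightarrow> real \<Rightarrow> 'a \<Rightarrow> bool" where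
  "slow k a \<omega> \<longleftrightarrow> (\<forall>j N. \<exists>n\<ge>N. f (word X k n \<omega>) < (a + 1 / Suc j) * n)"

lemma slow_shift:
  assumes \<omega>: "\<omega> \<in> space M"
  shows "slow 0 a \<omega> \<longleftrightarrow> slow k a \<omega>"
proof -
  have W: "set (word X k l \<omega>) \<subseteq> S" for k l
    using \<omega> by (rule word_in)
  have transfer: "\<forall>(j::nat) N. \<exists>n\<ge>N. h n < (a + 1 / Suc j) * n"
    if g: "\<forall>(j::nat) N. \<exists>n\<ge>N. g n < (a + 1 / Suc j) * n" and h: "\<And>n. n \<ge> k \<Longrightarrow> h n \<le> g n + real k"
    for g h :: "nat \<Rightarrow> real"
  proof (intro allI)
    fix j N :: nat
    \<comment> \<open>Half of the margin pays for the shift by \<open>k\<close>.\<close>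
    define j' where "j' = 2 * j + 1"
    have j': "1 / real (Suc j) = 2 * (1 / real (Suc j'))"
      by (simp add: j'_def field_simps)
    obtain n where n: "n \<ge> max (max N k) (k * Suc j')" "g n < (a + 1 / Suc j') * n"
      using g by meson
    have "real k * real (Suc j') \<le> real n"
      using n by (metis max.bounded_iff of_nat_le_iff of_nat_mult)
    then have "real k \<le> 1 / Suc j' * n"
      by (simp add: field_simps)
    moreover have "h n \<le> g n + real k"
      using n by (intro h) simp
    moreover define c where "c = 1 / real (Suc j')"
    ultimately have "h n < (a + 2 * c) * n"
      using n(2) by (simp add: distrib_right)
    then have "h n < (a + 1 / Suc j) * n"
      unfolding j' c_def .
    then show "\<exists>n\<ge>N. h n < (a + 1 / Suc j) * n"
      using n by auto
  qed
  have 1: "f (word X k n \<omega>) \<le> f (word X 0 n \<omega>) + real k" if "n \<ge> k" for n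
    using suffix[OF W[of 0 k] W[of k n]] that word_append[of 0 k n X \<omega>] by simp
  have 2: "f (word X 0 n \<omega>) \<le> f (word X k n \<omega>) + real k" if "n \<ge> k" for n
    using subadd[OF W[of 0 k] W[of k n]] bound[OF W[of 0 k]] that word_append[of 0 k n X \<omega>] by simp
  show ?thesis
    unfolding slow_def
    using transfer[of "\<lambda>n. f (word X 0 n \<omega>)" "\<lambda>n. f (word X k n \<omega>)", OF _ 1]
      transfer[of "\<lambda>n. f (word X k n \<omega>)" "\<lambda>n. f (word X 0 n \<omega>)", OF _ 2] by blast
qed

lemma slow_measurable:
  assumes "\<And>i. k \<le> i \<Longrightarrow> X i \<in> measurable N (count_space S)"
  shows "{\<omega> \<in> space N. slow k a \<omega>} \<in> sets N"
proof -
  have [measurable]: "(\<lambda>\<omega>. f (word X k n \<omega>)) \<in> borel_measurable N" for n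
    by (rule measurable_compose[OF measurable_word[OF finite_S assms]]) auto
  show ?thesis
    unfolding slow_def by measurable
qed

text \<open>
  The starting point of the word can be moved past any given index, hence this is a tail event.
\<close>

lemma slow_0_1: "prob {\<omega> \<in> space M. slow 0 a \<omega>} = 0 \<or> prob {\<omega> \<in> space M. slow 0 a \<omega>} = 1"
proof (rule kolmogorov_0_1_law)
  let ?A = "\<lambda>i. sigma_sets (space M) {X i -` A \<inter> space M |A. A \<in> sets (count_space S)}"
  show "sigma_algebra (space M) (?A i)" for i
    by (rule sigma_algebra_sigma_sets) auto
  show "indep_sets ?A UNIV"
    using indep by (simp add: indep_vars_def)
  show "{\<omega> \<in> space M. slow 0 a \<omega>} \<in> tail_events ?A"
    unfolding tail_events_def
  proof
    fix k
    let ?N = "sigma (space M) (\<Union>i\<in>{k..}. ?A i)"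
    have sub: "(\<Union>i\<in>{k..}. ?A i) \<subseteq> Pow (space M)"
    proof (intro UN_least subsetI PowI)
      fix i A x assume "A \<in> ?A i" "x \<in> A"
      then show "x \<in> space M"
        using sigma_sets_into_sp[of "{X i -` A \<inter> space M |A. A \<in> sets (count_space S)}" "space M" A]
        by auto
    qed
    have "X i \<in> measurable ?N (count_space S)" if "k \<le> i" for i
    proof (rule measurableI)
      fix A assume "A \<in> sets (count_space S)"
      then have "X i -` A \<inter> space M \<in> (\<Union>i\<in>{k..}. ?A i)"
        using that by (intro UN_I[of i] sigma_sets.Basic) auto
      then show "X i -` A \<inter> space ?N \<in> sets ?N"
        using sub by (simp add: space_measure_of_conv sigma_sets.Basic)
    qed (auto simp: space_measure_of_conv X_in)
    then have "{\<omega> \<in> space ?N. slow k a \<omega>} \<in> sets ?N"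
      by (rule slow_measurable)
    then show "{\<omega> \<in> space M. slow 0 a \<omega>} \<in> sigma_sets (space M) (\<Union>i\<in>{k..}. ?A i)"
      using sub slow_shift[of _ a k] by (simp add: space_measure_of_conv cong: conj_cong)
  qed
qed

lemma not_slow:
  assumes a: "a < rate"
  shows "AE \<omega> in M. \<not> slow 0 a \<omega>"
proof -
  have [measurable]: "{\<omega> \<in> space M. slow 0 a \<omega>} \<in> events"
    by (rule slow_measurable) simp
  have "prob {\<omega> \<in> space M. slow 0 a \<omega>} \<noteq> 1"
  proof
    assume "prob {\<omega> \<in> space M. slow 0 a \<omega>} = 1"
    then have AE: "AE \<omega> in M. slow 0 a \<omega>"
      by (simp add: prob_Collect_eq_1)
    obtain b where b: "a < b" "b < rate"
      using a dense by blast
    define G where "G N = {\<omega> \<in> space M. \<exists>j\<in>{1..N}. f (word X 0 j \<omega>) \<le> b * real j}" for N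
    have G_events [measurable]: "G N \<in> events" for N
      unfolding G_def by measurable
    have "AE \<omega> in M. \<omega> \<in> (\<Union>N. G N)"
      using AE AE_space
    proof eventually_elim
      case (elim \<omega>)
      obtain j where j: "1 / real (Suc j) < b - a"
        using b reals_Archimedean[of "b - a"] by (auto simp: inverse_eq_divide)
      obtain n where n: "n \<ge> 1" "f (word X 0 n \<omega>) < (a + 1 / Suc j) * n"
        using elim unfolding slow_def by blast
      have "(a + 1 / Suc j) * n \<le> b * n"
        using j by (intro mult_right_mono) auto
      then have "f (word X 0 n \<omega>) \<le> b * n"
        using n by linarith
      then have "\<omega> \<in> G n"
        using n elim by (auto simp: G_def)
      then show ?case by blast
    qed
    then have "prob (\<Union>N. G N) = 1"
      by (intro prob_eq_1[THEN iffD2]) auto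
    moreover have "(\<lambda>N. prob (G N)) \<longlonglongrightarrow> prob (\<Union>N. G N)"
    proof (intro finite_Lim_measure_incseq)
      show "incseq G"
        unfolding incseq_def G_def by fastforce
    qed auto
    ultimately have lim: "(\<lambda>N. prob (G N)) \<longlonglongrightarrow> 1"
      by simp
    \<comment> \<open>A bad position costs 1, so their density \<open>e\<close> has to stay below the gap between \<open>b\<close> and the rate.\<close>
    define e where "e = (rate - b) / 2"
    have e: "e > 0"
      using b by (simp add: e_def)
    then have "\<forall>\<^sub>F N in sequentially. max 0 (1 - e) < prob (G N)"
      using lim by (intro order_tendstoD(1)) auto
    then obtain N where N: "0 < prob (G N)" "1 - e < prob (G N)"
      by (auto dest: eventually_happens)
    then obtain \<omega>0 where "\<omega>0 \<in> G N"
      by (metis all_not_in_conv less_irrefl measure_empty)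
    then obtain j0 where "\<omega>0 \<in> space M" "j0 \<ge> 1" "f (word X 0 j0 \<omega>0) \<le> b * real j0"
      by (auto simp: G_def)
    then have "0 \<le> b * real j0" "real j0 > 0"
      using nonneg[OF word_in[of \<omega>0 0 j0]] by auto
    then have b0: "0 \<le> b"
      by (simp add: zero_le_mult_iff)
    let ?bad = "\<lambda>k \<omega>. \<forall>j\<in>{1..N}. b * real j < f (word X k (k + j) \<omega>)"
    have bad: "prob {\<omega> \<in> space M. ?bad k \<omega>} \<le> e" for k
    proof -
      let ?Q = "\<lambda>ws. \<forall>j\<in>{1..N}. b * real j < f (take j ws)"
      have eq: "?bad k \<omega> \<longleftrightarrow> ?Q (word X k (k + N) \<omega>)" for k \<omega>
        by (auto simp: take_word)
      have "prob {\<omega> \<in> space M. ?bad k \<omega>} = prob {\<omega> \<in> space M. ?bad 0 \<omega>}"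
        unfolding eq using prob_word_pred[of ?Q k N] prob_word_pred[of ?Q 0 N] by linarith
      also have "{\<omega> \<in> space M. ?bad 0 \<omega>} = space M - G N"
        by (auto simp: G_def not_le)
      also have "prob \<dots> = 1 - prob (G N)"
        by (rule prob_compl) simp
      finally show ?thesis
        using N by simp
    qed
    have bad_int: "expectation (\<lambda>\<omega>. of_bool (?bad k \<omega>)) \<le> e"
      "integrable M (\<lambda>\<omega>. of_bool (?bad k \<omega>) :: real)" for k
    proof -
      define C where "C = {\<omega> \<in> space M. ?bad k \<omega>}"
      have [measurable]: "C \<in> events"
        unfolding C_def by measurable
      have C: "indicator C \<omega> = (of_bool (?bad k \<omega>) :: real)" if "\<omega> \<in> space M" for \<omega>
        using that by (simp add: C_def indicator_def)
      have "expectation (\<lambda>\<omega>. of_bool (?bad k \<omega>) :: real) = expectation (indicator C)"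
        by (intro Bochner_Integration.integral_cong refl C[symmetric])
      also have "\<dots> = prob C"
        by simp
      finally show "expectation (\<lambda>\<omega>. of_bool (?bad k \<omega>)) \<le> e"
        using bad[of k] unfolding C_def by linarith
      have "integrable M (indicator C :: 'a \<Rightarrow> real)
          \<longleftrightarrow> integrable M (\<lambda>\<omega>. of_bool (?bad k \<omega>) :: real)"
        by (intro Bochner_Integration.integrable_cong refl C)
      then show "integrable M (\<lambda>\<omega>. of_bool (?bad k \<omega>) :: real)"
        by (simp add: less_top[symmetric])
    qed
    have upper: "mean_length n \<le> (b + e) * n + N" for n
    proof -
      define bd :: "nat \<Rightarrow> 'a \<Rightarrow> real" where "bd k \<omega> = of_bool (?bad k \<omega>)" for k \<omega>
      have bd: "integrable M (bd k)" "expectation (bd k) \<le> e" for k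
        using bad_int[of k] by (simp_all only: bd_def[abs_def])
      have "mean_length n = expectation (\<lambda>\<omega>. f (word X 0 n \<omega>))"
        using mean_length_eq[of n 0] by simp
      also have "\<dots> \<le> expectation (\<lambda>\<omega>. b * real n + (\<Sum>k\<in>{0..<n}. bd k \<omega>) + real N)"
      proof (rule integral_mono)
        show "f (word X 0 n \<omega>) \<le> b * real n + (\<Sum>k\<in>{0..<n}. bd k \<omega>) + real N" if "\<omega> \<in> space M" for \<omega>
          using tiling[OF that b0, of 0 n N] by (simp only: bd_def diff_zero le0 simp_thms)
      qed (use bd in simp_all)
      also have "\<dots> = b * real n + (\<Sum>k\<in>{0..<n}. expectation (bd k)) + real N"
        using bd by (simp add: prob_space)
      also have "\<dots> \<le> b * real n + (\<Sum>k\<in>{0..<n}. e) + real N"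
        by (intro add_mono sum_mono bd) auto
      finally show ?thesis
        by (simp add: algebra_simps)
    qed
    have "rate \<le> b + e"
    proof (rule field_le_epsilon)
      fix d :: real assume d: "0 < d"
      obtain n :: nat where n: "real N / d < real n"
        using reals_Archimedean2 by blast
      moreover have "0 \<le> real N / d"
        using d by simp
      ultimately have n0: "0 < real n"
        by linarith
      have "rate * n \<le> mean_length n"
        using rate_le[of n] n0 by (simp add: field_simps)
      also have "\<dots> \<le> (b + e) * n + N"
        by (rule upper)
      also have "\<dots> \<le> (b + e + d) * n"
        using n d by (simp add: field_simps)
      finally show "rate \<le> b + e + d"
        using n0 by simp
    qed
    then show False
      using b by (simp add: e_def field_simps)
  qed
  then have "prob {\<omega> \<in> space M. slow 0 a \<omega>} = 0"
    using slow_0_1 by blast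
  then show ?thesis
    by (subst (asm) prob_Collect_eq_0) auto
qed

lemma indep_blocks: "indep_vars (\<lambda>_. borel) (\<lambda>j \<omega>. f (word X (j * m) (j * m + m) \<omega>)) UNIV"
proof -
  let ?K = "\<lambda>j. {j * m..<j * m + m}"
  have "disjoint_family_on ?K UNIV"
    unfolding disjoint_family_on_def
  proof (intro ballI impI)
    fix i j :: nat assume ij: "i \<noteq> j"
    have "k div m = j" if "k \<in> ?K j" for k j
      using that by (intro div_nat_eqI) (auto simp: mult.commute)
    then show "?K i \<inter> ?K j = {}"
      using ij by blast
  qed
  then have "indep_vars (\<lambda>j. PiM (?K j) (\<lambda>_. count_space S)) (\<lambda>j \<omega>. restrict (\<lambda>i. X i \<omega>) (?K j)) UNIV"
    by (intro indep_vars_restrict[OF indep]) auto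
  then have "indep_vars (\<lambda>_. borel)
      (\<lambda>j \<omega>. (\<lambda>x. f (map x [j * m..<j * m + m])) (restrict (\<lambda>i. X i \<omega>) (?K j))) UNIV"
  proof (rule indep_vars_compose2)
    fix j :: nat

    let ?P = "PiM (?K j) (\<lambda>_. count_space S)"
    have "?P = count_space (Pi\<^sub>E (?K j) (\<lambda>_. S))"
      using finite_S by (intro count_space_PiM_finite) (auto simp: countable_finite)
    then show "(\<lambda>x. f (map x [j * m..<j * m + m])) \<in> borel_measurable ?P"
      by simp
  qed
  also have "(\<lambda>j \<omega>. (\<lambda>x. f (map x [j * m..<j * m + m])) (restrict (\<lambda>i. X i \<omega>) (?K j)))
      = (\<lambda>j \<omega>. f (word X (j * m) (j * m + m) \<omega>))"
    by (auto simp: word_def intro!: ext arg_cong[where f=f])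
  finally show ?thesis .
qed

lemma block_sums:
  assumes \<omega>: "\<omega> \<in> space M"
  shows "f (word X 0 (k * m) \<omega>) \<le> (\<Sum>j<k. f (word X (j * m) (j * m + m) \<omega>))"
proof (induction k)
  case 0
  then show ?case
    using bound[of "[]"] by simp
next
  case (Suc k)
  have "f (word X 0 (Suc k * m) \<omega>) \<le> f (word X 0 (k * m) \<omega>) + f (word X (k * m) (k * m + m) \<omega>)"
    using word_append[of 0 "k * m" "Suc k * m" X \<omega>] subadd[OF word_in word_in, OF \<omega> \<omega>]
    by (simp add: add.commute)
  then show ?case
    using Suc by simp
qed

text \<open>
  Blocks of length \<open>m\<close> are independent and bounded, so the deviations of their sums above the mean
  have exponentially small, hence summable, probabilities.
\<close>

lemma eventually_le_mean:
  assumes m: "1 \<le> m" and e: "0 < e"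
  shows "AE \<omega> in M. \<forall>\<^sub>F n in sequentially. f (word X 0 n \<omega>) \<le> (mean_length m / m + e) * n"
proof -
  define Y where "Y j \<omega> = f (word X (j * m) (j * m + m) \<omega>)" for j \<omega>
  define d where "d = e / 2 * m"
  define A where "A k = {\<omega> \<in> space M. (\<Sum>j<k. Y j \<omega>) \<ge> k * mean_length m + k * d}" for k
  have d: "d > 0"
    using m e by (simp add: d_def)
  have Y_meas [measurable]: "Y j \<in> borel_measurable M" for j
    unfolding Y_def by simp
  have A_meas [measurable]: "A k \<in> events" for k
    unfolding A_def by measurable
  define r where "r = exp (- (2 * d\<^sup>2 / m\<^sup>2))"
  have r: "norm r < 1"
    using d m by (simp add: r_def)
  have hoeffding: "prob (A k) \<le> r ^ k" for k
  proof (cases "k = 0")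
    case False
    have expY: "expectation (Y j) = mean_length m" for j
      unfolding Y_def by (simp add: mean_length_eq[symmetric])
    interpret H: Hoeffding_ineq M "{..<k}" Y "\<lambda>_. 0" "\<lambda>_. real m" "k * mean_length m"
    proof unfold_locales
      show "indep_vars (\<lambda>_. borel) Y {..<k}"
        unfolding Y_def using indep_blocks by (rule indep_vars_subset) simp
      show "AE \<omega> in M. Y j \<omega> \<in> {0..real m}" if "j \<in> {..<k}" for j
      proof (rule AE_I2)
        fix \<omega> assume \<omega>: "\<omega> \<in> space M"
        show "Y j \<omega> \<in> {0..real m}"
          using nonneg[OF word_in[OF \<omega>]] bound[OF word_in[OF \<omega>], of "j * m" "j * m + m"]
          by (auto simp: Y_def)
      qed
    qed (auto simp: expY)
    have "prob (A k) \<le> exp (- 2 * (k * d)\<^sup>2 / (\<Sum>i<k. (real m - 0)\<^sup>2))"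
      unfolding A_def using d m False by (intro H.Hoeffding_ineq_ge) auto
    also have "- 2 * (k * d)\<^sup>2 / (\<Sum>i<k. (real m - 0)\<^sup>2) = k * (- (2 * d\<^sup>2 / m\<^sup>2))"
      using False m by (simp add: field_simps power2_eq_square)
    also have "exp \<dots> = r ^ k"
      unfolding r_def by (rule exp_of_nat_mult)
    finally show ?thesis .
  qed simp
  have "summable (\<lambda>k. prob (A k))"
    by (rule summable_comparison_test'[OF summable_geometric[OF r], of 0]) (use hoeffding in auto)
  then have "AE \<omega> in M. \<forall>\<^sub>F k in sequentially. \<omega> \<in> space M - A k"
    by (intro borel_cantelli_AE1) (auto simp: less_top[symmetric])
  then show ?thesis
    using AE_space
  proof eventually_elim
    case (elim \<omega>)
    have W: "set (word X k l \<omega>) \<subseteq> S" for k l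
      using elim(2) by (rule word_in)
    from elim(1) obtain K where K: "\<And>k. k \<ge> K \<Longrightarrow> \<omega> \<notin> A k"
      by (auto simp: eventually_sequentially)
    obtain N :: nat where N: "real m / (e / 2) < real N"
      using reals_Archimedean2 by blast
    show ?case
      unfolding eventually_sequentially
    proof (intro exI allI impI)
      fix n assume n: "max N (K * m) \<le> n"
      define k where "k = n div m"
      have "K \<le> k"
        using n m by (simp add: k_def less_eq_div_iff_mult_less_eq)
      have km: "k * m \<le> n" "n - k * m \<le> m"
        using m by (auto simp: k_def minus_div_mult_eq_mod intro: less_imp_le)
      have split: "f (word X 0 n \<omega>) \<le> f (word X 0 (k * m) \<omega>) + f (word X (k * m) n \<omega>)"
        using word_append[of 0 "k * m" n X \<omega>] km subadd[OF W W] by simp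
      have rest: "f (word X (k * m) n \<omega>) \<le> m"
        using bound[OF W, of "k * m" n] km(2) unfolding length_word
        by (meson of_nat_le_iff order_trans)
      have "f (word X 0 (k * m) \<omega>) \<le> (\<Sum>j<k. Y j \<omega>)"
        unfolding Y_def by (rule block_sums[OF elim(2)])
      also have "\<dots> \<le> k * mean_length m + k * d"
        using K[OF \<open>K \<le> k\<close>] elim(2) by (simp add: A_def)
      also have "\<dots> = (mean_length m / m + e / 2) * (k * m)"
        using m by (simp add: d_def field_simps)
      also have "\<dots> \<le> (mean_length m / m + e / 2) * n"
      proof (rule mult_left_mono)
        show "real (k * m) \<le> real n"
          using km(1) by (rule of_nat_mono)
      qed (use mean_length_nonneg[of m] e in auto)
      finally have blocks: "f (word X 0 (k * m) \<omega>) \<le> (mean_length m / m + e / 2) * n" .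
      have "real m \<le> e / 2 * n"
      proof -
        have "real m \<le> e / 2 * real N"
          using N e by (simp add: field_simps)
        also have "\<dots> \<le> e / 2 * n"
          using n e by (intro mult_left_mono) auto
        finally show ?thesis .
      qed
      then have "f (word X 0 n \<omega>) \<le> (mean_length m / m + e / 2) * n + e / 2 * n"
        using split rest blocks by linarith
      also have "\<dots> = (mean_length m / m + e) * n"
        unfolding distrib_right[symmetric] by simp
      finally show "f (word X 0 n \<omega>) \<le> (mean_length m / m + e) * n" .
    qed
  qed
qed

theorem AE_tendsto_rate: "AE \<omega> in M. (\<lambda>n. f (word X 0 n \<omega>) / n) \<longlonglongrightarrow> rate"
proof -
  have lower: "AE \<omega> in M. \<forall>j. \<not> slow 0 (rate - 1 / Suc j) \<omega>"
    unfolding AE_all_countable by (intro allI not_slow) simp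
  have upper: "AE \<omega> in M. \<forall>j. \<forall>\<^sub>F n in sequentially. f (word X 0 n \<omega>) \<le> (rate + 1 / Suc j) * n"
    unfolding AE_all_countable
  proof
    fix j
    obtain m where m: "m \<ge> 1" "mean_length m / m < rate + 1 / Suc j"
      using rate_less[of "rate + 1 / Suc j"] by auto
    show "AE \<omega> in M. \<forall>\<^sub>F n in sequentially. f (word X 0 n \<omega>) \<le> (rate + 1 / Suc j) * n"
      using eventually_le_mean[OF m(1), of "rate + 1 / Suc j - mean_length m / m"] m by simp
  qed
  show ?thesis
    using lower upper
  proof eventually_elim
    case (elim \<omega>)
    show ?case
    proof (rule order_tendstoI)
      fix a assume "a < rate"
      then obtain j where j: "1 / real (Suc j) < rate - a"
        using reals_Archimedean[of "rate - a"] by (auto simp: inverse_eq_divide)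
      have "\<not> slow 0 (rate - 1 / Suc j) \<omega>"
        using elim by blast
      then obtain i N where iN: "\<And>n. n \<ge> N \<Longrightarrow> (rate - 1 / Suc j + 1 / Suc i) * n \<le> f (word X 0 n \<omega>)"
        unfolding slow_def by (auto simp: not_less)
      have "a < f (word X 0 n \<omega>) / n" if n: "n \<ge> max N 1" for n
      proof -
        have "a * n < (rate - 1 / Suc j + 1 / Suc i) * n"
        proof (rule mult_strict_right_mono)
          have "0 < 1 / real (Suc i)"
            by simp
          then show "a < rate - 1 / Suc j + 1 / Suc i"
            using j by linarith
        qed (use n in simp)
        also have "\<dots> \<le> f (word X 0 n \<omega>)"
          using n by (intro iN) auto
        finally show ?thesis
          using n by (simp add: field_simps)
      qed
      then show "\<forall>\<^sub>F n in sequentially. a < f (word X 0 n \<omega>) / n"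
        unfolding eventually_sequentially by blast
    next
      fix a assume "rate < a"
      then obtain j where j: "1 / real (Suc j) < a - rate"
        using reals_Archimedean[of "a - rate"] by (auto simp: inverse_eq_divide)
      have "\<forall>\<^sub>F n in sequentially. f (word X 0 n \<omega>) \<le> (rate + 1 / Suc j) * n"
        using elim by blast
      then show "\<forall>\<^sub>F n in sequentially. f (word X 0 n \<omega>) / n < a"
        using eventually_gt_at_top[of 0]
      proof eventually_elim
        case (elim n)
        have "(rate + 1 / Suc j) * n < a * n"
          using j elim by (intro mult_strict_right_mono) auto
        with elim have "f (word X 0 n \<omega>) < a * n"
          by linarith
        with elim show ?case
          by (simp add: divide_less_eq)
      qed
    qed
  qed
qed

corollary mean_length_tendsto: "(\<lambda>n. mean_length n / n) \<longlonglongrightarrow> rate"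
proof -
  have "(\<lambda>n. expectation (\<lambda>\<omega>. f (word X 0 n \<omega>) / n)) \<longlonglongrightarrow> expectation (\<lambda>\<omega>. rate)"
  proof (rule integral_dominated_convergence[where w="\<lambda>_. 1"])
    show "AE \<omega> in M. norm (f (word X 0 n \<omega>) / n) \<le> 1" for n
    proof (rule AE_I2)
      fix \<omega> assume \<omega>: "\<omega> \<in> space M"
      show "norm (f (word X 0 n \<omega>) / n) \<le> 1"
        using nonneg[OF word_in[OF \<omega>], of 0 n] bound[OF word_in[OF \<omega>], of 0 n]
        by (cases "n = 0") (auto simp: field_simps)
    qed
  qed (use AE_tendsto_rate in auto)
  then show ?thesis
    using mean_length_eq[of _ 0] by (simp add: prob_space)
qed

end

section \<open>Word length in Cayley graphs\<close>

lemma relpow_symI: "(g, h) \<in> R ^^ n \<Longrightarrow> sym R \<Longrightarrow> (h, g) \<in> R ^^ n"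
proof (induction n arbitrary: h)
  case (Suc n)
  then obtain k where "(g, k) \<in> R ^^ n" "(k, h) \<in> R"
    by auto
  with Suc have "(k, g) \<in> R ^^ n" "(h, k) \<in> R"
    by (auto dest: symD)
  then show ?case
    by (metis relpow_Suc_I2)
qed auto

lemma sym_cayley_edges: "sym (cayley_edges G S)"
  by (auto simp: sym_def cayley_edges_def)

lemma cayley_dist_le: "(g, h) \<in> cayley_edges G S ^^ n \<Longrightarrow> cayley_dist G S g h \<le> n"
  unfolding cayley_dist_def by (rule Least_le)

lemma cayley_dist_path:
  "(g, h) \<in> cayley_edges G S ^^ n \<Longrightarrow> (g, h) \<in> cayley_edges G S ^^ cayley_dist G S g h"
  unfolding cayley_dist_def by (rule LeastI)

definition word_product :: "('a, 'b) monoid_scheme \<Rightarrow> 'a list \<Rightarrow> 'a" where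
  "word_product G ws = foldl (monoid.mult G) \<one>\<^bsub>G\<^esub> ws"

lemma word_product_Nil [simp]: "word_product G [] = \<one>\<^bsub>G\<^esub>"
  by (simp add: word_product_def)

lemma word_product_snoc [simp]:
  "word_product G (ws @ [s]) = word_product G ws \<otimes>\<^bsub>G\<^esub> s"
  by (simp add: word_product_def)

context group
begin

lemma cayley_edges_translate:
  assumes "k \<in> carrier G" "S \<subseteq> carrier G" "(g, h) \<in> cayley_edges G S"
  shows "(k \<otimes> g, k \<otimes> h) \<in> cayley_edges G S"
  using assms unfolding cayley_edges_def by (auto simp: m_assoc subset_eq)

lemma cayley_path_translate:
  assumes k: "k \<in> carrier G" and S: "S \<subseteq> carrier G"
  shows "(g, h) \<in> cayley_edges G S ^^ n \<Longrightarrow> (k \<otimes> g, k \<otimes> h) \<in> cayley_edges G S ^^ n"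
proof (induction n arbitrary: h)
  case (Suc n)
  then show ?case
    using cayley_edges_translate[OF k S] by (auto intro!: relcompI)
qed simp

lemma word_product_closed [simp, intro]:
  "S \<subseteq> carrier G \<Longrightarrow> set ws \<subseteq> S \<Longrightarrow> word_product G ws \<in> carrier G"
  by (induction ws rule: rev_induct) auto

lemma word_product_append:
  assumes S: "S \<subseteq> carrier G"
  shows "set xs \<subseteq> S \<Longrightarrow> set ys \<subseteq> S \<Longrightarrow>
    word_product G (xs @ ys) = word_product G xs \<otimes> word_product G ys"
proof (induction ys rule: rev_induct)
  case Nil
  then show ?case using S by simp
next
  case (snoc y ys)
  then show ?case
    using S word_product_snoc[of G "xs @ ys" y] by (auto simp: m_assoc subset_eq word_product_closed)
qed

lemma cayley_path_word_product:
  assumes S: "S \<subseteq> carrier G"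
  shows "set ws \<subseteq> S \<Longrightarrow> (\<one>, word_product G ws) \<in> cayley_edges G S ^^ length ws"
proof (induction ws rule: rev_induct)
  case (snoc s ws)
  then have "(word_product G ws, word_product G (ws @ [s])) \<in> cayley_edges G S"
    using S by (auto simp: cayley_edges_def)
  with snoc show ?case
    by (auto intro!: relcompI)
qed simp

text \<open>
  Left translation is an automorphism of the Cayley graph, so a path for \<open>ys\<close> can be appended to a
  path for \<open>xs\<close>, and the path for \<open>xs\<close> can be removed again.
\<close>

lemma cayley_length_word_product:
  assumes S: "S \<subseteq> carrier G" and xs: "set xs \<subseteq> S" and ys: "set ys \<subseteq> S"
  defines "len \<equiv> \<lambda>ws. cayley_dist G S (word_product G ws) \<one>"
  shows cayley_length_path: "(word_product G xs, \<one>) \<in> cayley_edges G S ^^ len xs"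
    and cayley_length_le: "len xs \<le> length xs"
    and cayley_length_append: "len (xs @ ys) \<le> len xs + len ys"
    and cayley_length_suffix: "len ys \<le> length xs + len (xs @ ys)"
proof -
  have path: "(word_product G ws, \<one>) \<in> cayley_edges G S ^^ length ws" if "set ws \<subseteq> S" for ws
    using cayley_path_word_product[OF S that] sym_cayley_edges by (rule relpow_symI)
  have len_path: "(word_product G ws, \<one>) \<in> cayley_edges G S ^^ len ws" if "set ws \<subseteq> S" for ws
    unfolding len_def using path[OF that] by (rule cayley_dist_path)
  have cl: "word_product G xs \<in> carrier G" "word_product G ys \<in> carrier G"
    using S xs ys by auto
  show "(word_product G xs, \<one>) \<in> cayley_edges G S ^^ len xs"
    by (rule len_path[OF xs])
  show "len xs \<le> length xs"
    unfolding len_def using path[OF xs] by (rule cayley_dist_le)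
  have app: "word_product G (xs @ ys) = word_product G xs \<otimes> word_product G ys"
    by (rule word_product_append[OF S xs ys])
  have "(word_product G (xs @ ys), word_product G xs) \<in> cayley_edges G S ^^ len ys"
    using cayley_path_translate[OF cl(1) S len_path[OF ys]] cl by (simp add: app)
  then have "(word_product G (xs @ ys), \<one>) \<in> cayley_edges G S ^^ (len ys + len xs)"
    using len_path[OF xs] unfolding relpow_add by auto
  then have "len (xs @ ys) \<le> len ys + len xs"
    unfolding len_def by (rule cayley_dist_le)
  then show "len (xs @ ys) \<le> len xs + len ys"
    by simp
  have "set (xs @ ys) \<subseteq> S"
    using xs ys by simp
  have "(inv (word_product G xs) \<otimes> word_product G (xs @ ys), inv (word_product G xs) \<otimes> \<one>)
      \<in> cayley_edges G S ^^ len (xs @ ys)"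
    using cl by (intro cayley_path_translate S len_path) (use xs ys in auto)
  moreover have "inv (word_product G xs) \<otimes> word_product G (xs @ ys) = word_product G ys"
    using cl by (simp add: app m_assoc[symmetric])
  moreover have "(inv (word_product G xs) \<otimes> \<one>, inv (word_product G xs) \<otimes> word_product G xs)
      \<in> cayley_edges G S ^^ length xs"
    using cl by (intro cayley_path_translate S cayley_path_word_product xs) auto
  ultimately have "(word_product G ys, \<one>) \<in> cayley_edges G S ^^ (len (xs @ ys) + length xs)"
    using cl unfolding relpow_add by (auto intro!: relcompI)
  then have "len ys \<le> len (xs @ ys) + length xs"
    unfolding len_def by (rule cayley_dist_le)
  then show "len ys \<le> length xs + len (xs @ ys)"
    by simp
qed

end

section \<open>The free product of copies of the group of order two\<close>

lemma tree_carrier: "w \<in> carrier (tree_group q) \<longleftrightarrow> set w \<subseteq> {..<q} \<and> distinct_adj w"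
  by (simp add: tree_group_def)

lemma tree_mult: "x \<otimes>\<^bsub>tree_group q\<^esub> y = foldr letter_mult x y"
  by (simp add: tree_group_def)

lemma tree_one [simp]: "\<one>\<^bsub>tree_group q\<^esub> = []"
  by (simp add: tree_group_def)

lemma letter_mult_reduced:
  "a < q \<Longrightarrow> w \<in> carrier (tree_group q) \<Longrightarrow> letter_mult a w \<in> carrier (tree_group q)"
  by (cases w) (auto simp: tree_carrier distinct_adj_Cons)

lemma letter_mult_involution: "distinct_adj w \<Longrightarrow> letter_mult a (letter_mult a w) = w"
proof (cases w)
  case (Cons b v)
  assume "distinct_adj w"
  then show ?thesis
    using Cons by (cases v) auto
qed simp

lemma tree_mult_closed:
  "x \<in> carrier (tree_group q) \<Longrightarrow> y \<in> carrier (tree_group q) \<Longrightarrow>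
    foldr letter_mult x y \<in> carrier (tree_group q)"
proof (induction x)
  case (Cons a x)
  then have "x \<in> carrier (tree_group q)" "a < q"
    by (auto simp: tree_carrier dest: distinct_adj_ConsD)
  with Cons show ?case
    by (simp add: letter_mult_reduced)
qed simp

text \<open>
  Since \<open>letter_mult a\<close> is an involution on reduced words, it does not matter whether a letter
  cancels before or after a multiplication from the right.
\<close>

lemma foldr_letter_mult:
  assumes "distinct_adj (foldr letter_mult (tl u) z)"
  shows "foldr letter_mult (letter_mult a u) z = letter_mult a (foldr letter_mult u z)"
  using assms by (cases u) (auto simp: letter_mult_involution)

lemma tree_mult_assoc:
  assumes y: "y \<in> carrier (tree_group q)" and z: "z \<in> carrier (tree_group q)"
  shows "x \<in> carrier (tree_group q) \<Longrightarrow>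
    foldr letter_mult (foldr letter_mult x y) z = foldr letter_mult x (foldr letter_mult y z)"
proof (induction x)
  case (Cons a x)
  then have x: "x \<in> carrier (tree_group q)"
    by (auto simp: tree_carrier dest: distinct_adj_ConsD)
  have "foldr letter_mult x y \<in> carrier (tree_group q)"
    using x y by (rule tree_mult_closed)
  then have "tl (foldr letter_mult x y) \<in> carrier (tree_group q)"
    by (cases "foldr letter_mult x y") (auto simp: tree_carrier dest: distinct_adj_ConsD)
  then have "foldr letter_mult (tl (foldr letter_mult x y)) z \<in> carrier (tree_group q)"
    using z by (rule tree_mult_closed)
  with Cons x show ?case
    by (simp add: foldr_letter_mult tree_carrier)
qed simp

lemma tree_inverse: "foldr letter_mult (rev x) x = []"
proof (induction x)
  case (Cons a x)
  have "letter_mult a (a # x) = x" by simp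
  with Cons show ?case by simp
qed simp

lemma group_tree_group: "group (tree_group q)"
proof (rule groupI)
  fix x assume "x \<in> carrier (tree_group q)"
  then show "\<exists>y\<in>carrier (tree_group q). y \<otimes>\<^bsub>tree_group q\<^esub> x = \<one>\<^bsub>tree_group q\<^esub>"
    by (intro bexI[of _ "rev x"]) (auto simp: tree_mult tree_inverse tree_carrier)
qed (auto simp: tree_mult tree_mult_closed tree_mult_assoc, auto simp: tree_carrier)

definition move :: "nat list \<Rightarrow> nat \<Rightarrow> nat list" where
  "move x a = (if x \<noteq> [] \<and> last x = a then butlast x else x @ [a])"

lemma foldr_letter_mult_append: "distinct_adj (x @ z) \<Longrightarrow> foldr letter_mult x z = x @ z"
proof (induction x)
  case (Cons a x)
  then have "foldr letter_mult x z = x @ z"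
    by (metis append_Cons distinct_adj_ConsD)
  with Cons.prems show ?case
    by (cases "x @ z") auto
qed simp

lemma tree_mult_letter:
  assumes x: "x \<in> carrier (tree_group q)"
  shows "x \<otimes>\<^bsub>tree_group q\<^esub> [a] = move x a"
proof (cases "x = [] \<or> last x \<noteq> a")
  case True
  then have "distinct_adj (x @ [a])"
    using x by (auto simp: tree_carrier distinct_adj_append_iff)
  with True show ?thesis
    by (auto simp: tree_mult move_def foldr_letter_mult_append)
next
  case False
  then obtain y where y: "x = y @ [a]"
    by (metis append_butlast_last_id)
  then have "distinct_adj y"
    using x by (auto simp: tree_carrier)
  then have "foldr letter_mult y [] = y"
    using foldr_letter_mult_append[of y "[]"] by simp
  then show ?thesis
    by (simp add: tree_mult y move_def)
qed

lemma letter_reduced: "a < q \<Longrightarrow> [a] \<in> carrier (tree_group q)"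
  by (simp add: tree_carrier)

lemma move_reduced: "a < q \<Longrightarrow> x \<in> carrier (tree_group q) \<Longrightarrow> move x a \<in> carrier (tree_group q)"
  using group.is_monoid[OF group_tree_group, of q]
  by (simp add: tree_mult_letter[symmetric] monoid.m_closed letter_reduced)

section \<open>The lamplighter group\<close>

(* This rule rewrites sums of lamp states to truth values, which hides that the
   lamps form a group under pointwise addition. *)
declare add_bit_eq_xor [simp del]

lemma configuration_outside:
  "\<eta> \<in> configurations q \<Longrightarrow> w \<notin> carrier (tree_group q) \<Longrightarrow> \<eta> w = 0"
  by (auto simp: configurations_def lamps_on_def)

lemma configurations_add:
  assumes "\<eta> \<in> configurations q" "\<zeta> \<in> configurations q"
  shows "(\<lambda>w. \<eta> w + \<zeta> w) \<in> configurations q"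
proof -
  have "lamps_on (\<lambda>w. \<eta> w + \<zeta> w) \<subseteq> lamps_on \<eta> \<union> lamps_on \<zeta>"
    by (auto simp: lamps_on_def)
  with assms show ?thesis
    by (auto simp: configurations_def intro: finite_subset)
qed

lemma translate_configuration:
  assumes x: "x \<in> carrier (tree_group q)" and \<eta>: "\<eta> \<in> configurations q"
  shows "translate q x \<eta> \<in> configurations q"
proof -
  interpret T: group "tree_group q" by (rule group_tree_group)
  have "lamps_on (translate q x \<eta>) \<subseteq> (\<lambda>v. x \<otimes>\<^bsub>tree_group q\<^esub> v) ` lamps_on \<eta>"
  proof
    fix w assume "w \<in> lamps_on (translate q x \<eta>)"
    then have w: "w \<in> carrier (tree_group q)" "inv\<^bsub>tree_group q\<^esub> x \<otimes>\<^bsub>tree_group q\<^esub> w \<in> lamps_on \<eta>"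
      by (auto simp: lamps_on_def translate_def split: if_splits)
    moreover have "w = x \<otimes>\<^bsub>tree_group q\<^esub> (inv\<^bsub>tree_group q\<^esub> x \<otimes>\<^bsub>tree_group q\<^esub> w)"
      using x w T.l_one[OF w(1)] by (simp add: T.m_assoc[symmetric])
    ultimately show "w \<in> (\<lambda>v. x \<otimes>\<^bsub>tree_group q\<^esub> v) ` lamps_on \<eta>"
      by blast
  qed
  moreover have "lamps_on (translate q x \<eta>) \<subseteq> carrier (tree_group q)"
    by (auto simp: lamps_on_def translate_def split: if_splits)
  ultimately show ?thesis
    using \<eta> by (auto simp: configurations_def intro: finite_subset)
qed

lemma translate_translate:
  assumes "x \<in> carrier (tree_group q)" "y \<in> carrier (tree_group q)"
  shows "translate q x (translate q y \<eta>) = translate q (x \<otimes>\<^bsub>tree_group q\<^esub> y) \<eta>"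
proof -
  interpret T: group "tree_group q" by (rule group_tree_group)
  show ?thesis
    using assms by (auto simp: translate_def fun_eq_iff T.inv_mult_group T.m_assoc)
qed

lemma translate_add:
  "translate q x (\<lambda>w. \<eta> w + \<zeta> w) = (\<lambda>w. translate q x \<eta> w + translate q x \<zeta> w)"
  by (auto simp: translate_def)

lemma translate_one: "\<eta> \<in> configurations q \<Longrightarrow> translate q [] \<eta> = \<eta>"
proof -
  interpret T: group "tree_group q" by (rule group_tree_group)
  assume "\<eta> \<in> configurations q"
  then show ?thesis
    using T.inv_one T.l_one configuration_outside
    by (auto simp: translate_def fun_eq_iff simp del: T.inv_one T.l_one)
qed

lemma lamplighter_carrier:
  "g \<in> carrier (lamplighter_group q) \<longleftrightarrow> fst g \<in> configurations q \<and> snd g \<in> carrier (tree_group q)"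
  by (cases g) (simp add: lamplighter_group_def)

lemma lamplighter_mult:
  "g \<otimes>\<^bsub>lamplighter_group q\<^esub> h =
    (\<lambda>w. fst g w + translate q (snd g) (fst h) w, snd g \<otimes>\<^bsub>tree_group q\<^esub> snd h)"
  by (simp add: lamplighter_group_def case_prod_unfold)

lemma lamplighter_one: "\<one>\<^bsub>lamplighter_group q\<^esub> = (\<lambda>w. 0, [])"
  by (simp add: lamplighter_group_def)

lemma bit_add_self: "(b::bit) + b = 0"
  by (simp add: add_bit_eq_xor)

lemma group_lamplighter_group: "group (lamplighter_group q)"
proof (rule groupI)
  interpret T: group "tree_group q" by (rule group_tree_group)
  let ?L = "lamplighter_group q"
  show "\<one>\<^bsub>?L\<^esub> \<in> carrier ?L"
    by (auto simp: lamplighter_carrier lamplighter_one configurations_def lamps_on_def tree_carrier)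
  show "g \<otimes>\<^bsub>?L\<^esub> h \<in> carrier ?L" if "g \<in> carrier ?L" "h \<in> carrier ?L" for g h
    using that unfolding lamplighter_carrier lamplighter_mult fst_conv snd_conv
    by (intro conjI configurations_add translate_configuration T.m_closed) auto
  show "g \<otimes>\<^bsub>?L\<^esub> h \<otimes>\<^bsub>?L\<^esub> k = g \<otimes>\<^bsub>?L\<^esub> (h \<otimes>\<^bsub>?L\<^esub> k)"
    if "g \<in> carrier ?L" "h \<in> carrier ?L" "k \<in> carrier ?L" for g h k
    using that by (simp add: lamplighter_carrier lamplighter_mult translate_add translate_translate
        add.assoc T.m_assoc)
  show "\<one>\<^bsub>?L\<^esub> \<otimes>\<^bsub>?L\<^esub> g = g" if "g \<in> carrier ?L" for g
    using that T.l_one[of "snd g"]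
    by (simp add: lamplighter_carrier lamplighter_mult lamplighter_one translate_one)
  show "\<exists>h\<in>carrier ?L. h \<otimes>\<^bsub>?L\<^esub> g = \<one>\<^bsub>?L\<^esub>" if g: "g \<in> carrier ?L" for g
  proof
    let ?x = "inv\<^bsub>tree_group q\<^esub> snd g"
    let ?h = "(translate q ?x (fst g), ?x)"
    show "?h \<in> carrier ?L"
      using g by (simp add: lamplighter_carrier translate_configuration)
    show "?h \<otimes>\<^bsub>?L\<^esub> g = \<one>\<^bsub>?L\<^esub>"
      using g T.l_inv[of "snd g"] by (simp add: lamplighter_mult lamplighter_one bit_add_self lamplighter_carrier)
  qed
qed

text \<open>
  The generator that switches the lamp at the current vertex if \<open>u\<close>, walks along \<open>a\<close>, and switches
  the lamp at the new vertex if \<open>v\<close>. The two decisions are independent under the step distribution.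
\<close>

definition switch_step :: "nat \<Rightarrow> bool \<Rightarrow> bool \<Rightarrow> lamplighter" where
  "switch_step a u v = (\<lambda>w. of_bool (w = [] \<and> u \<or> w = [a] \<and> v), [a])"

lemma of_bool_bit_eq_0 [simp]: "(of_bool b :: bit) = 0 \<longleftrightarrow> \<not> b"
  by (cases b) auto

lemma lamps_switch_step:
  "lamps_on (fst (switch_step a u v)) = (if u then {[]} else {}) \<union> (if v then {[a]} else {})"
  by (auto simp: lamps_on_def switch_step_def)

lemma switch_step_carrier:
  assumes "a < q" shows "switch_step a u v \<in> carrier (lamplighter_group q)"
proof -
  have "fst (switch_step a u v) \<in> configurations q"
    unfolding configurations_def mem_Collect_eq lamps_switch_step using assms
    by (auto simp: tree_carrier)
  then show ?thesis
    using assms by (simp add: lamplighter_carrier switch_step_def tree_carrier)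
qed

lemma indicator_eq_of_bool: "indicator A = (\<lambda>w. of_bool (w \<in> A) :: bit)"
  by (auto simp: indicator_def fun_eq_iff)

lemma sws_generators_eq:
  "sws_generators q = (\<lambda>(a, u, v). switch_step a u v) ` ({..<q} \<times> UNIV \<times> UNIV)"
proof (intro equalityI subsetI)
  fix g assume "g \<in> sws_generators q"
  then obtain A a where g: "g = (indicator A, [a])" "a < q" "A \<in> {{}, {[]}, {[a]}, {[], [a]}}"
    by (auto simp: sws_generators_def)
  then have "g = switch_step a ([] \<in> A) ([a] \<in> A)"
    by (auto simp: switch_step_def indicator_eq_of_bool fun_eq_iff)
  with g show "g \<in> (\<lambda>(a, u, v). switch_step a u v) ` ({..<q} \<times> UNIV \<times> UNIV)"
    by (intro image_eqI[of _ _ "(a, [] \<in> A, [a] \<in> A)"]) auto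
next
  fix g assume "g \<in> (\<lambda>(a, u, v). switch_step a u v) ` ({..<q} \<times> UNIV \<times> UNIV)"
  then obtain a u v where g: "a < q" "g = switch_step a u v"
    by auto
  let ?A = "(if u then {[]} else {}) \<union> (if v then {[a]} else {})"
  have "g = (indicator ?A, [a])"
    by (auto simp: g switch_step_def indicator_eq_of_bool fun_eq_iff)
  moreover have "?A \<in> {{}, {[]}, {[a]}, {[], [a]}}"
    by auto
  ultimately show "g \<in> sws_generators q"
    unfolding sws_generators_def using g(1) by blast
qed

lemma inj_switch_step: "inj_on (\<lambda>(a, u, v). switch_step a u v) A"
proof (rule inj_onI)
  fix y z :: "nat \<times> bool \<times> bool"
  obtain a u v b s t where yz: "y = (a, u, v)" "z = (b, s, t)"
    by (metis prod_cases3)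
  assume "(case y of (a, u, v) \<Rightarrow> switch_step a u v) = (case z of (a, u, v) \<Rightarrow> switch_step a u v)"
  then have eq: "switch_step a u v = switch_step b s t"
    by (simp add: yz)
  then have "a = b" by (simp add: switch_step_def)
  have "fst (switch_step a u v) [] = fst (switch_step b s t) []"
    "fst (switch_step a u v) [a] = fst (switch_step b s t) [a]"
    using eq by auto
  then show "y = z"
    unfolding yz using \<open>a = b\<close> by (cases u; cases v; cases s; cases t; simp add: switch_step_def)
qed

lemma finite_sws_generators: "finite (sws_generators q)"
  by (simp add: sws_generators_eq)

lemma sws_generators_carrier: "sws_generators q \<subseteq> carrier (lamplighter_group q)"
  by (auto simp: sws_generators_eq switch_step_carrier)

definition switch_prob :: "real \<Rightarrow> bool \<Rightarrow> real" where
  "switch_prob p u = (if u then p else 1 - p)"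

lemma sws_weight_switch_step:
  assumes "a < q"
  shows "sws_weight q p (switch_step a u v) = switch_prob p u * switch_prob p v / q"
proof -
  have "switch_step a u v \<in> sws_generators q"
    unfolding sws_generators_eq using assms by (intro image_eqI[of _ _ "(a, u, v)"]) auto
  then show ?thesis
    unfolding sws_weight_def lamps_switch_step
    by (auto simp: switch_prob_def Let_def power2_eq_square)
qed

lemma mult_switch_step:
  assumes g: "(\<eta>, x) \<in> carrier (lamplighter_group q)" and a: "a < q"
  shows "(\<eta>, x) \<otimes>\<^bsub>lamplighter_group q\<^esub> switch_step a u v =
    (\<lambda>w. \<eta> w + of_bool (w = x \<and> u \<or> w = move x a \<and> v), move x a)"
proof -
  interpret T: group "tree_group q" by (rule group_tree_group)
  have x: "x \<in> carrier (tree_group q)"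
    using g by (simp add: lamplighter_carrier)
  have "translate q x (fst (switch_step a u v)) w = of_bool (w = x \<and> u \<or> w = move x a \<and> v)" for w
  proof (cases "w \<in> carrier (tree_group q)")
    case True
    have "inv\<^bsub>tree_group q\<^esub> x \<otimes>\<^bsub>tree_group q\<^esub> w = y \<longleftrightarrow> w = x \<otimes>\<^bsub>tree_group q\<^esub> y"
      if "y \<in> carrier (tree_group q)" for y
      using T.inv_solve_left'[of y x w] that x True by auto
    from this[of "[]"] this[of "[a]"] show ?thesis
      using True a x T.r_one[OF x]
      by (simp add: translate_def switch_step_def tree_mult_letter letter_reduced tree_carrier)
  next
    case False
    then show ?thesis
      using x move_reduced[OF a x] by (auto simp: translate_def)
  qed
  then show ?thesis
    using x by (simp add: lamplighter_mult fun_eq_iff) (simp add: switch_step_def tree_mult_letter)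
qed

section \<open>A lower bound for the length\<close>

text \<open>
  The edges of the smallest subtree that contains the root, the position and all lit vertices. An edge is
  represented by its endpoint farther from the root, which is why the empty word is left out.
\<close>

definition spanned_tree :: "lamplighter \<Rightarrow> nat list set" where
  "spanned_tree g = {u. u \<noteq> [] \<and> (\<exists>w\<in>insert (snd g) (lamps_on (fst g)). prefix u w)}"

text \<open>
  The length of a shortest walk in the tree that starts at the root, visits every lit vertex and
  ends at the position: it crosses the edges on the geodesic once and the others twice.
\<close>

definition excursion_length :: "lamplighter \<Rightarrow> int" where
  "excursion_length g = 2 * int (card (spanned_tree g)) - int (length (snd g))"

lemma finite_spanned_tree: "finite (lamps_on (fst g)) \<Longrightarrow> finite (spanned_tree g)"
proof -
  assume "finite (lamps_on (fst g))"
  then have "finite (\<Union>w\<in>insert (snd g) (lamps_on (fst g)). {u. prefix u w})"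
    by (auto simp: set_prefixes_eq[symmetric] simp del: set_prefixes_eq)
  then show ?thesis
    by (rule rev_finite_subset) (auto simp: spanned_tree_def)
qed

text \<open>
  A step outwards adds at most one edge to the subtree and moves the position along it; a step towards
  the root adds no edge. A switched lamp sits at an end of the crossed edge, so it adds nothing more.
\<close>

lemma excursion_length_neighbour:
  assumes fin: "finite (lamps_on (fst g))"
    and agree: "lamps_on (fst h) \<subseteq> lamps_on (fst g) \<union> {snd g, snd h}"
    and adj: "snd h = snd g @ [a] \<or> snd g = snd h @ [a]"
  shows "excursion_length h \<le> excursion_length g + 1"
  using adj
proof
  assume h: "snd h = snd g @ [a]"
  have "spanned_tree h \<subseteq> insert (snd h) (spanned_tree g)"
    using agree by (auto simp: spanned_tree_def h)
  then have "card (spanned_tree h) \<le> card (insert (snd h) (spanned_tree g))"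
    using finite_spanned_tree[OF fin] by (intro card_mono) auto
  also have "\<dots> \<le> Suc (card (spanned_tree g))"
    by (rule card_insert_le_m1) auto
  finally show ?thesis
    by (simp add: excursion_length_def h)
next
  assume g: "snd g = snd h @ [a]"
  have "spanned_tree h \<subseteq> spanned_tree g"
    using agree by (auto simp: spanned_tree_def g)
  then have "card (spanned_tree h) \<le> card (spanned_tree g)"
    using finite_spanned_tree[OF fin] by (intro card_mono)
  then show ?thesis
    by (simp add: excursion_length_def g)
qed

lemma mult_generator_adjacent:
  assumes g: "g \<in> carrier (lamplighter_group q)" and s: "s \<in> sws_generators q"
    and h: "h = g \<otimes>\<^bsub>lamplighter_group q\<^esub> s"
  shows "\<exists>a. snd h = snd g @ [a] \<or> snd g = snd h @ [a]"
    and "\<And>w. w \<noteq> snd g \<Longrightarrow> w \<noteq> snd h \<Longrightarrow> fst h w = fst g w"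
proof -
  obtain a u v where s: "s = switch_step a u v" "a < q"
    using s by (auto simp: sws_generators_eq)
  obtain \<eta> x where g': "g = (\<eta>, x)" by (cases g)
  have h': "h = (\<lambda>w. \<eta> w + of_bool (w = x \<and> u \<or> w = move x a \<and> v), move x a)"
    unfolding h s g' using g s unfolding g' by (intro mult_switch_step)
  show "\<exists>a. snd h = snd g @ [a] \<or> snd g = snd h @ [a]"
    by (auto simp: h' g' move_def) (metis append_butlast_last_id)
  show "fst h w = fst g w" if "w \<noteq> snd g" "w \<noteq> snd h" for w
    using that by (simp add: h' g')
qed

lemma excursion_length_edge:
  assumes "(g, h) \<in> cayley_edges (lamplighter_group q) (sws_generators q)"
  shows "excursion_length g \<le> excursion_length h + 1"
proof -
  have gh: "g \<in> carrier (lamplighter_group q)" "h \<in> carrier (lamplighter_group q)"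
    using assms by (auto simp: cayley_edges_def)
  obtain s where "s \<in> sws_generators q"
    "h = g \<otimes>\<^bsub>lamplighter_group q\<^esub> s \<or> g = h \<otimes>\<^bsub>lamplighter_group q\<^esub> s"
    using assms by (auto simp: cayley_edges_def)
  then have "(\<exists>a. snd h = snd g @ [a] \<or> snd g = snd h @ [a])
      \<and> (\<forall>w. w \<noteq> snd g \<longrightarrow> w \<noteq> snd h \<longrightarrow> fst h w = fst g w)"
    using mult_generator_adjacent[OF gh(1)] mult_generator_adjacent[OF gh(2)] by metis
  then obtain a where a: "snd h = snd g @ [a] \<or> snd g = snd h @ [a]"
    and "\<And>w. w \<noteq> snd g \<Longrightarrow> w \<noteq> snd h \<Longrightarrow> fst h w = fst g w"
    by blast
  then have "lamps_on (fst g) \<subseteq> lamps_on (fst h) \<union> {snd h, snd g}"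
    by (auto simp: lamps_on_def)
  moreover have "finite (lamps_on (fst h))"
    using gh by (auto simp: lamplighter_carrier configurations_def)
  ultimately show ?thesis
    using a by (intro excursion_length_neighbour[where a=a]) auto
qed

lemma excursion_length_le_path:
  "(g, \<one>\<^bsub>lamplighter_group q\<^esub>) \<in> cayley_edges (lamplighter_group q) (sws_generators q) ^^ n
    \<Longrightarrow> excursion_length g \<le> int n"
proof (induction n arbitrary: g)
  case 0
  then show ?case
    by (simp add: excursion_length_def spanned_tree_def lamplighter_one lamps_on_def)
next
  case (Suc n)
  then obtain h where "(g, h) \<in> cayley_edges (lamplighter_group q) (sws_generators q)"
    "(h, \<one>\<^bsub>lamplighter_group q\<^esub>) \<in> cayley_edges (lamplighter_group q) (sws_generators q) ^^ n"
    by (meson relpow_Suc_D2)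
  with Suc.IH[of h] excursion_length_edge[of g h q] show ?case
    by auto
qed

text \<open>
  The vertex \<open>take j x\<close> of the geodesic from the root to \<open>x\<close> has a lit child off this geodesic.
\<close>

definition side_lamp :: "(nat list \<Rightarrow> bit) \<Rightarrow> nat list \<Rightarrow> nat \<Rightarrow> bool" where
  "side_lamp \<eta> x j \<longleftrightarrow> (\<exists>a. a \<noteq> x ! j \<and> \<eta> (take j x @ [a]) \<noteq> 0)"

text \<open>
  The probability that simple random walk on the tree, started at distance \<open>r\<close> from a vertex, never
  visits that vertex.
\<close>

definition escape_prob :: "nat \<Rightarrow> nat \<Rightarrow> real" where
  "escape_prob q r = 1 - (1 / (real q - 1)) ^ r"

lemma escape_prob_nonneg:
  assumes "2 \<le> q" shows "0 \<le> escape_prob q r"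
proof -
  have "(1 / (real q - 1)) ^ r \<le> 1"
    using assms by (intro power_le_one) auto
  then show ?thesis
    by (simp add: escape_prob_def)
qed

text \<open>
  Each geodesic vertex with a side lamp is weighted with the probability that the walk never returns to
  it; until such a return the lamp stays beside the geodesic. The position itself does not count, so
  nothing is lost when the walk enters one of its lit children.
\<close>

definition branch_potential :: "nat \<Rightarrow> lamplighter \<Rightarrow> real" where
  "branch_potential q g =
    (\<Sum>j<length (snd g). escape_prob q (length (snd g) - j) * of_bool (side_lamp (fst g) (snd g) j))"

text \<open>
  The prefixes of the position and one lit child for each vertex that has a side lamp are distinct edges
  of the spanned subtree.
\<close>

lemma branch_potential_le_excursion:
  assumes fin: "finite (lamps_on (fst g))" and q: "2 \<le> q"
  shows "real (length (snd g)) + 2 * branch_potential q g \<le> excursion_length g"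
proof -
  obtain \<eta> x where g: "g = (\<eta>, x)" by (cases g)
  let ?J = "{j. j < length x \<and> side_lamp \<eta> x j}"
  define c where "c j = (SOME a. a \<noteq> x ! j \<and> \<eta> (take j x @ [a]) \<noteq> 0)" for j
  have c: "c j \<noteq> x ! j" "\<eta> (take j x @ [c j]) \<noteq> 0" if "j \<in> ?J" for j
    using that someI_ex[of "\<lambda>a. a \<noteq> x ! j \<and> \<eta> (take j x @ [a]) \<noteq> 0"]
    by (auto simp: side_lamp_def c_def)
  let ?A = "(\<lambda>j. take (Suc j) x) ` {..<length x}"
  let ?B = "(\<lambda>j. take j x @ [c j]) ` ?J"
  have "card ?A = length x"
  proof -
    have "inj_on (\<lambda>j. take (Suc j) x) {..<length x}"
      by (rule inj_onI) (metis Suc_inject Suc_leI length_take lessThan_iff min.absorb2)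
    then show ?thesis by (simp add: card_image)
  qed
  moreover have "card ?B = card ?J"
  proof -
    have "inj_on (\<lambda>j. take j x @ [c j]) ?J"
      by (rule inj_onI) (metis (mono_tags, lifting) append1_eq_conv length_take less_imp_le mem_Collect_eq min.absorb2)
    then show ?thesis by (simp add: card_image)
  qed
  moreover have "?A \<inter> ?B = {}"
  proof -
    have False if "i < length x" "j \<in> ?J" "take (Suc i) x = take j x @ [c j]" for i j
    proof -
      have "length (take (Suc i) x) = length (take j x @ [c j])"
        using that by simp
      then have "i = j"
        using that(1,2) by (simp add: min_def split: if_splits)
      then have "x ! j = c j"
        using that by (simp add: take_Suc_conv_app_nth)
      then show False
        using c that by metis
    qed
    then show ?thesis by blast
  qed
  moreover have "?A \<union> ?B \<subseteq> spanned_tree g"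
    using c by (auto simp: spanned_tree_def g take_is_prefix lamps_on_def)
  then have "card (?A \<union> ?B) \<le> card (spanned_tree g)"
    using finite_spanned_tree[OF fin] by (intro card_mono)
  ultimately have "length x + card ?J \<le> card (spanned_tree g)"
    by (simp add: card_Un_disjoint)
  moreover have "branch_potential q g \<le> card ?J"
  proof -
    have "branch_potential q g \<le> (\<Sum>j<length x. of_bool (side_lamp \<eta> x j))"
      unfolding branch_potential_def g fst_conv snd_conv
    proof (rule sum_mono)
      fix j
      have "escape_prob q (length x - j) \<le> 1"
        using q by (simp add: escape_prob_def)
      then show "escape_prob q (length x - j) * of_bool (side_lamp \<eta> x j) \<le> of_bool (side_lamp \<eta> x j)"
        by (simp add: of_bool_def)
    qed
    also have "\<dots> = card ?J"
      by (simp add: sum.If_cases of_bool_def Int_def)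
    finally show ?thesis .
  qed
  ultimately show ?thesis
    by (simp add: excursion_length_def g)
qed

section \<open>Averages over one step\<close>

definition step_mean :: "nat \<Rightarrow> real \<Rightarrow> (lamplighter \<Rightarrow> real) \<Rightarrow> lamplighter \<Rightarrow> real" where
  "step_mean q p F g = (\<Sum>s\<in>sws_generators q. sws_weight q p s * F (g \<otimes>\<^bsub>lamplighter_group q\<^esub> s))"

lemma sum_sws_generators:
  "(\<Sum>s\<in>sws_generators q. sws_weight q p s * F s) =
    (\<Sum>a<q. \<Sum>u\<in>UNIV. \<Sum>v\<in>UNIV. switch_prob p u * switch_prob p v * F (switch_step a u v)) / q"
proof -
  have "(\<Sum>s\<in>sws_generators q. sws_weight q p s * F s) =
    (\<Sum>(a, u, v)\<in>{..<q} \<times> UNIV \<times> UNIV. sws_weight q p (switch_step a u v) * F (switch_step a u v))"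
    unfolding sws_generators_eq
    by (subst sum.reindex[OF inj_switch_step]) (simp add: case_prod_unfold)
  also have "\<dots> = (\<Sum>(a, u, v)\<in>{..<q} \<times> UNIV \<times> UNIV.
      switch_prob p u * switch_prob p v * F (switch_step a u v) / q)"
    by (intro sum.cong) (auto simp: sws_weight_switch_step)
  finally show ?thesis
    by (simp add: sum.cartesian_product sum_divide_distrib case_prod_unfold)
qed

lemma step_mean_eq:
  "step_mean q p F g = (\<Sum>a<q. \<Sum>u\<in>UNIV. \<Sum>v\<in>UNIV.
    switch_prob p u * switch_prob p v * F (g \<otimes>\<^bsub>lamplighter_group q\<^esub> switch_step a u v)) / q"
  unfolding step_mean_def by (rule sum_sws_generators)

lemma sum_sws_weight: "0 < q \<Longrightarrow> (\<Sum>s\<in>sws_generators q. sws_weight q p s) = 1"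
  using sum_sws_generators[of q p "\<lambda>_. 1"] by (simp add: UNIV_bool switch_prob_def algebra_simps)

lemma sws_weight_nonneg: "0 \<le> p \<Longrightarrow> p \<le> 1 \<Longrightarrow> 0 \<le> sws_weight q p s"
  by (simp add: sws_weight_def Let_def)

lemma step_mean_switch_free:
  assumes "\<And>a u v. a < q \<Longrightarrow> F (g \<otimes>\<^bsub>lamplighter_group q\<^esub> switch_step a u v) = H a"
  shows "step_mean q p F g = (\<Sum>a<q. H a) / q"
  using assms by (simp add: step_mean_eq UNIV_bool switch_prob_def algebra_simps)

lemma forward_letters:
  assumes q: "1 \<le> q" and x: "x \<in> carrier (tree_group q)"
  defines "W \<equiv> {a. a < q \<and> \<not> (x \<noteq> [] \<and> last x = a)}"
  shows "finite W" "q - 1 \<le> card W"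
proof -
  show "finite W" by (simp add: W_def)
  have "{..<q} - {last x} \<subseteq> W"
    by (auto simp: W_def)
  then have "card ({..<q} - {last x}) \<le> card W"
    using \<open>finite W\<close> by (rule card_mono[rotated])
  then show "q - 1 \<le> card W"
    by (simp add: card_Diff_singleton_if split: if_splits)
qed

text \<open>
  At most one letter leads back towards the root.
\<close>

lemma step_mean_length:
  assumes q: "1 \<le> q" and g: "g \<in> carrier (lamplighter_group q)"
  shows "real (length (snd g)) + (real q - 2) / q \<le> step_mean q p (\<lambda>h. real (length (snd h))) g"
proof -
  obtain \<eta> x where g': "g = (\<eta>, x)" by (cases g)
  have x: "x \<in> carrier (tree_group q)"
    using g by (simp add: g' lamplighter_carrier)
  let ?W = "{a. a < q \<and> \<not> (x \<noteq> [] \<and> last x = a)}"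
  have "step_mean q p (\<lambda>h. real (length (snd h))) g = (\<Sum>a<q. real (length (move x a))) / q"
    using g by (intro step_mean_switch_free) (simp add: g' mult_switch_step)
  moreover have "real q * (real (length x) - 1) + 2 * (real q - 1) \<le> (\<Sum>a<q. real (length (move x a)))"
  proof -
    have "real q - 1 \<le> real (card ?W)"
      using forward_letters[OF q x] by linarith
    then have "real q * (real (length x) - 1) + 2 * (real q - 1) \<le> real q * (real (length x) - 1) + 2 * real (card ?W)"
      by simp
    also have "\<dots> = (\<Sum>a<q. real (length x) - 1 + 2 * of_bool (a \<in> ?W))"
      by (simp add: sum.distrib sum_distrib_left[symmetric] of_bool_def sum.If_cases Int_def lessThan_def)
    also have "\<dots> \<le> (\<Sum>a<q. real (length (move x a)))"
      by (intro sum_mono) (auto simp: move_def of_nat_diff Suc_leI)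
    finally show ?thesis .
  qed
  ultimately show ?thesis
    using q by (simp add: g' field_simps)
qed

text \<open>
  A step switches only lamps at its two ends, which lie on the old or the new geodesic, never beside it.
\<close>

lemma side_lamp_step:
  assumes g: "(\<eta>, x) \<in> carrier (lamplighter_group q)" and a: "a < q"
    and h: "(\<zeta>, y) = (\<eta>, x) \<otimes>\<^bsub>lamplighter_group q\<^esub> switch_step a u v"
    and j: "j < length x" "j < length y"
  shows "side_lamp \<zeta> y j = side_lamp \<eta> x j"
proof -
  have y: "y = move x a" and \<zeta>: "\<zeta> = (\<lambda>w. \<eta> w + of_bool (w = x \<and> u \<or> w = y \<and> v))"
    using h unfolding mult_switch_step[OF g a] by auto
  have eq: "take j y = take j x" "y ! j = x ! j"
    using j unfolding y move_def by (auto simp: nth_append nth_butlast butlast_conv_take)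
  have off: "take j z @ [c] \<noteq> z" if "j < length z" "c \<noteq> z ! j" for c z
  proof
    assume "take j z @ [c] = z"
    moreover have "(take j z @ [c]) ! j = c"
      using that by (simp add: nth_append)
    ultimately show False
      using that by metis
  qed
  have "\<zeta> (take j x @ [c]) = \<eta> (take j x @ [c])" if "c \<noteq> x ! j" for c
    using off[OF j(1)] off[OF j(2)] that eq by (auto simp: \<zeta>)
  then show ?thesis
    unfolding side_lamp_def eq by auto
qed

text \<open>
  A step backwards shortens all distances by one, where \<open>escape_prob q 0 = 0\<close> removes the vertex that
  has become the position. A step forwards lengthens them and exposes the lit children of the
  vertex that is left.
\<close>

lemma branch_potential_step:
  assumes g: "(\<eta>, x) \<in> carrier (lamplighter_group q)" and a: "a < q"
  shows "branch_potential q ((\<eta>, x) \<otimes>\<^bsub>lamplighter_group q\<^esub> switch_step a u v) =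
    (if x \<noteq> [] \<and> last x = a
     then \<Sum>j<length x. escape_prob q (length x - 1 - j) * of_bool (side_lamp \<eta> x j)
     else (\<Sum>j<length x. escape_prob q (length x + 1 - j) * of_bool (side_lamp \<eta> x j))
       + escape_prob q 1 * of_bool (\<exists>c. c \<noteq> a \<and> \<eta> (x @ [c]) \<noteq> 0))"
proof -
  let ?\<zeta> = "\<lambda>w. \<eta> w + of_bool (w = x \<and> u \<or> w = move x a \<and> v) :: bit"
  note step = mult_switch_step[OF g a, of u v]
  note keep = side_lamp_step[OF g a, of ?\<zeta> "move x a" u v, unfolded step, OF refl]
  show ?thesis
  proof (cases "x \<noteq> [] \<and> last x = a")
    case True
    then have m: "move x a = butlast x" by (simp add: move_def)
    obtain d where d: "length x = Suc d"
      using True by (cases x) auto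
    have "branch_potential q (?\<zeta>, move x a) =
        (\<Sum>j<d. escape_prob q (d - j) * of_bool (side_lamp \<eta> x j))"
      unfolding branch_potential_def using keep m d by (intro sum.cong) auto
    also have "\<dots> = (\<Sum>j<length x. escape_prob q (length x - 1 - j) * of_bool (side_lamp \<eta> x j))"
      by (simp add: d escape_prob_def)
    finally show ?thesis
      using True by (simp add: step)
  next
    case False
    then have m: "move x a = x @ [a]" by (auto simp: move_def)
    have tip: "side_lamp ?\<zeta> (move x a) (length x) \<longleftrightarrow> (\<exists>c. c \<noteq> a \<and> \<eta> (x @ [c]) \<noteq> 0)"
      unfolding side_lamp_def by (auto simp: m)
    have "branch_potential q (?\<zeta>, move x a) =
      (\<Sum>j<length x. escape_prob q (length x + 1 - j) * of_bool (side_lamp ?\<zeta> (move x a) j))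
       + escape_prob q 1 * of_bool (side_lamp ?\<zeta> (move x a) (length x))"
      unfolding branch_potential_def by (simp add: m)
    also have "\<dots> = (\<Sum>j<length x. escape_prob q (length x + 1 - j) * of_bool (side_lamp \<eta> x j))
       + escape_prob q 1 * of_bool (\<exists>c. c \<noteq> a \<and> \<eta> (x @ [c]) \<noteq> 0)"
      unfolding tip using keep m by (intro arg_cong2[of _ _ _ _ "(+)"] sum.cong refl) auto
    finally show ?thesis
      unfolding step if_not_P[OF False] .
  qed
qed

lemma escape_prob_harmonic:
  assumes "2 \<le> q" "0 < r"
  shows "(real q - 1) * escape_prob q (r + 1) + escape_prob q (r - 1) = q * escape_prob q r"
proof -
  obtain k where r: "r = Suc k"
    using assms gr0_implies_Suc by blast
  define t where "t = 1 / (real q - 1)"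
  have t: "(real q - 1) * (t * y) = y" for y
    using assms by (simp add: t_def)
  have "(real q - 1) * t ^ Suc (Suc k) = t ^ Suc k" "(real q - 1) * t ^ Suc k = t ^ k"
    using t[of "t ^ Suc k"] t[of "t ^ k"] by simp_all
  then show ?thesis
    unfolding escape_prob_def t_def[symmetric] r by (simp add: algebra_simps)
qed

definition child_lit :: "lamplighter \<Rightarrow> bool" where
  "child_lit g \<longleftrightarrow> (\<exists>c. fst g (snd g @ [c]) \<noteq> 0)"

text \<open>
  By harmonicity the old contributions are preserved on average. If the position has a lit child
  \<open>c\<close>, then every outward letter other than \<open>c\<close> turns it into a side lamp, and there are at least
  \<open>q - 2\<close> such letters.
\<close>

lemma step_mean_branch_potential:
  assumes q: "2 \<le> q" and g: "g \<in> carrier (lamplighter_group q)"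
  shows "branch_potential q g + escape_prob q 1 * (real q - 2) / q * of_bool (child_lit g)
    \<le> step_mean q p (branch_potential q) g"
proof -
  obtain \<eta> x where g': "g = (\<eta>, x)" by (cases g)
  have x: "x \<in> carrier (tree_group q)" and \<eta>: "\<eta> \<in> configurations q"
    using g by (simp_all add: g' lamplighter_carrier)
  let ?W = "{a. a < q \<and> \<not> (x \<noteq> [] \<and> last x = a)}"
  let ?L = "\<lambda>j. of_bool (side_lamp \<eta> x j) :: real"
  let ?tip = "\<lambda>a. \<exists>c. c \<noteq> a \<and> \<eta> (x @ [c]) \<noteq> 0"
  define B where "B = (\<Sum>j<length x. escape_prob q (length x - 1 - j) * ?L j)"
  define U where "U = (\<Sum>j<length x. escape_prob q (length x + 1 - j) * ?L j)"
  have e1: "0 \<le> escape_prob q 1"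
    using q by (simp add: escape_prob_def)
  have "step_mean q p (branch_potential q) g =
      (\<Sum>a<q. if x \<noteq> [] \<and> last x = a then B else U + escape_prob q 1 * of_bool (?tip a)) / q"
    unfolding B_def U_def using g unfolding g'
    by (intro step_mean_switch_free branch_potential_step)
  also have "(\<Sum>a<q. if x \<noteq> [] \<and> last x = a then B else U + escape_prob q 1 * of_bool (?tip a)) =
      (\<Sum>a<q. if x \<noteq> [] \<and> last x = a then B else U) + (\<Sum>a\<in>?W. escape_prob q 1 * of_bool (?tip a))"
  proof -
    have "(\<Sum>a\<in>?W. escape_prob q 1 * of_bool (?tip a)) =
        (\<Sum>a<q. if x \<noteq> [] \<and> last x = a then 0 else escape_prob q 1 * of_bool (?tip a))"
      by (rule sum.mono_neutral_cong_left) auto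
    then show ?thesis
      by (simp only: sum.distrib[symmetric]) (auto intro!: sum.cong)
  qed
  also have "(\<Sum>a<q. if x \<noteq> [] \<and> last x = a then B else U) = q * branch_potential q g"
  proof (cases "x = []")
    case True
    then show ?thesis by (simp add: U_def branch_potential_def g')
  next
    case False
    have "set x \<subseteq> {..<q}"
      using x by (simp add: tree_carrier)
    then have "last x \<in> {..<q}"
      using last_in_set[OF False] by (rule subsetD)
    then have "last x < q"
      by simp
    then have "(\<Sum>a<q. if x \<noteq> [] \<and> last x = a then B else U) = B + (real q - 1) * U"
      using False q by (subst sum.remove[of _ "last x"]) (auto simp: of_nat_diff)
    also have "\<dots> = (\<Sum>j<length x. q * (escape_prob q (length x - j) * ?L j))"
      unfolding B_def U_def sum_distrib_left sum.distrib[symmetric]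
    proof (rule sum.cong)
      fix j assume j: "j \<in> {..<length x}"
      have "(real q - 1) * escape_prob q (length x - j + 1) + escape_prob q (length x - j - 1)
          = q * escape_prob q (length x - j)"
        using q j by (intro escape_prob_harmonic) auto
      moreover have "length x - j + 1 = length x + 1 - j" "length x - j - 1 = length x - 1 - j"
        using j by auto
      ultimately show "escape_prob q (length x - 1 - j) * ?L j + (real q - 1) * (escape_prob q (length x + 1 - j) * ?L j)
          = q * (escape_prob q (length x - j) * ?L j)"
        by (auto simp: of_bool_def)
    qed simp
    finally show ?thesis
      unfolding branch_potential_def g' fst_conv snd_conv sum_distrib_left .
  qed
  finally have step: "step_mean q p (branch_potential q) g =
      (q * branch_potential q g + (\<Sum>a\<in>?W. escape_prob q 1 * of_bool (?tip a))) / q" .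
  have drift: "(real q - 2) * (escape_prob q 1 * of_bool (child_lit g)) \<le> (\<Sum>a\<in>?W. escape_prob q 1 * of_bool (?tip a))"
  proof (cases "child_lit g")
    case True
    then obtain c where c: "\<eta> (x @ [c]) \<noteq> 0"
      by (auto simp: child_lit_def g')
    have "q - 1 \<le> card ?W" "finite ?W"
      using forward_letters[OF _ x] q by auto
    then have "q - 2 \<le> card (?W - {c})"
      using diff_card_le_card_Diff[of "{c}" ?W] by simp
    then have "real q - 2 \<le> card (?W - {c})"
      by linarith
    then have "(real q - 2) * (escape_prob q 1 * of_bool (child_lit g)) \<le> card (?W - {c}) * escape_prob q 1"
      using e1 True by (simp add: mult_right_mono)
    also have "\<dots> = (\<Sum>a\<in>?W - {c}. escape_prob q 1)"
      by simp
    also have "\<dots> = (\<Sum>a\<in>?W - {c}. escape_prob q 1 * of_bool (?tip a))"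
    proof (rule sum.cong)
      fix a assume "a \<in> ?W - {c}"
      then have "?tip a"
        using c by (intro exI[of _ c]) auto
      then show "escape_prob q 1 = escape_prob q 1 * of_bool (?tip a)"
        by (simp only: of_bool_eq mult_1_right)
    qed simp
    also have "\<dots> \<le> (\<Sum>a\<in>?W. escape_prob q 1 * of_bool (?tip a))"
      using e1 by (intro sum_mono2) auto
    finally show ?thesis .
  qed (use e1 in \<open>auto intro!: sum_nonneg\<close>)
  have "branch_potential q g + escape_prob q 1 * (real q - 2) / q * of_bool (child_lit g) =
      (q * branch_potential q g + (real q - 2) * (escape_prob q 1 * of_bool (child_lit g))) / q"
    using q by (simp add: field_simps)
  also have "\<dots> \<le> step_mean q p (branch_potential q) g"
    unfolding step by (intro divide_right_mono add_left_mono drift) simp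
  finally show ?thesis .
qed

lemma step_mean_nonneg:
  assumes "0 \<le> p" "p \<le> 1" "\<And>h. 0 \<le> F h"
  shows "0 \<le> step_mean q p F g"
  unfolding step_mean_def using assms by (intro sum_nonneg mult_nonneg_nonneg sws_weight_nonneg) auto

text \<open>
  Consider only a step outwards along \<open>a\<close> followed by the step back. The lamp at the child is subject to
  the second switch of the first step and to the first switch of the second step. If it was off,
  it ends up lit with probability \<open>2p(1 - p)\<close>; if it was on, with probability
  \<open>1 - 2p(1 - p)\<close>, which is at least as large.
\<close>

lemma two_step_child_lit:
  assumes q: "1 \<le> q" and p: "0 \<le> p" "p \<le> 1" and g: "g \<in> carrier (lamplighter_group q)"
  shows "(real q - 1) / q\<^sup>2 * (2 * p * (1 - p))
    \<le> step_mean q p (step_mean q p (\<lambda>h. of_bool (child_lit h))) g"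
proof -
  obtain \<eta> x where g': "g = (\<eta>, x)" by (cases g)
  have x: "x \<in> carrier (tree_group q)" and \<eta>: "\<eta> \<in> configurations q"
    using g by (simp_all add: g' lamplighter_carrier)
  let ?L = "lamplighter_group q"
  interpret group ?L by (rule group_lamplighter_group)
  let ?W = "{a. a < q \<and> \<not> (x \<noteq> [] \<and> last x = a)}"
  let ?r = "switch_prob p"
  let ?lit = "\<lambda>h. of_bool (child_lit h) :: real"
  let ?h = "\<lambda>a u v. g \<otimes>\<^bsub>?L\<^esub> switch_step a u v"
  have r: "0 \<le> ?r u" for u
    using p by (simp add: switch_prob_def)
  have return: "(\<Sum>s\<in>UNIV. ?r s * of_bool (\<eta> (x @ [a]) \<noteq> 0 \<longleftrightarrow> v = s)) / q \<le> step_mean q p ?lit (?h a u v)"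
    if a: "a \<in> ?W" for a u v
  proof -
    have m: "move x a = x @ [a]" "move (x @ [a]) a = x"
      using a by (auto simp: move_def)
    let ?\<zeta> = "\<lambda>w. \<eta> w + of_bool (w = x \<and> u \<or> w = x @ [a] \<and> v)"
    have h: "?h a u v = (?\<zeta>, x @ [a])"
      using g a unfolding g' by (subst mult_switch_step) (auto simp: m)
    have hc: "(?\<zeta>, x @ [a]) \<in> carrier ?L"
      using g a h[symmetric] by (simp add: switch_step_carrier)
    have lit: "of_bool (\<eta> (x @ [a]) \<noteq> 0 \<longleftrightarrow> v = s) \<le> ?lit (?h a u v \<otimes>\<^bsub>?L\<^esub> switch_step a s t)" for s t
    proof -
      have "?h a u v \<otimes>\<^bsub>?L\<^esub> switch_step a s t =
          (\<lambda>w. ?\<zeta> w + of_bool (w = x @ [a] \<and> s \<or> w = x \<and> t), x)"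
        unfolding h using a by (subst mult_switch_step[OF hc]) (auto simp: m)
      moreover have "\<eta> (x @ [a]) + of_bool v + of_bool s \<noteq> 0" if "\<eta> (x @ [a]) \<noteq> 0 \<longleftrightarrow> v = s"
        using that by (cases "\<eta> (x @ [a])"; cases v; cases s) auto
      ultimately show ?thesis
        by (auto simp: child_lit_def)
    qed
    have "(\<Sum>s\<in>UNIV. ?r s * of_bool (\<eta> (x @ [a]) \<noteq> 0 \<longleftrightarrow> v = s)) =
        (\<Sum>s\<in>UNIV. \<Sum>t\<in>UNIV. ?r s * ?r t * of_bool (\<eta> (x @ [a]) \<noteq> 0 \<longleftrightarrow> v = s))"
      by (simp add: UNIV_bool switch_prob_def algebra_simps)
    also have "\<dots> \<le> (\<Sum>s\<in>UNIV. \<Sum>t\<in>UNIV. ?r s * ?r t * ?lit (?h a u v \<otimes>\<^bsub>?L\<^esub> switch_step a s t))"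
      by (intro sum_mono mult_left_mono lit mult_nonneg_nonneg r)
    also have "\<dots> \<le> (\<Sum>b<q. \<Sum>s\<in>UNIV. \<Sum>t\<in>UNIV. ?r s * ?r t * ?lit (?h a u v \<otimes>\<^bsub>?L\<^esub> switch_step b s t))"
      using a r by (intro member_le_sum sum_nonneg mult_nonneg_nonneg) auto
    finally show ?thesis
      unfolding step_mean_eq by (rule divide_right_mono) simp
  qed
  have parity: "2 * p * (1 - p) \<le> (\<Sum>u\<in>UNIV. \<Sum>v\<in>UNIV. ?r u * ?r v * (\<Sum>s\<in>UNIV. ?r s * of_bool (b \<longleftrightarrow> v = s)))"
    for b
  proof -
    have "0 \<le> (2 * p - 1)\<^sup>2"
      by simp
    then show ?thesis
      by (cases b) (simp_all add: UNIV_bool switch_prob_def power2_eq_square algebra_simps)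
  qed
  have "(real q - 1) * (2 * p * (1 - p) / q) \<le> card ?W * (2 * p * (1 - p) / q)"
    using forward_letters[OF q x] p q by (intro mult_right_mono) auto
  also have "\<dots> = (\<Sum>a\<in>?W. 2 * p * (1 - p) / q)"
    by simp
  also have "\<dots> \<le> (\<Sum>a\<in>?W. \<Sum>u\<in>UNIV. \<Sum>v\<in>UNIV. ?r u * ?r v * step_mean q p ?lit (?h a u v))"
  proof (rule sum_mono)
    fix a assume a: "a \<in> ?W"
    let ?b = "\<eta> (x @ [a]) \<noteq> 0"
    have "2 * p * (1 - p) / q \<le> (\<Sum>u\<in>UNIV. \<Sum>v\<in>UNIV. ?r u * ?r v * (\<Sum>s\<in>UNIV. ?r s * of_bool (?b \<longleftrightarrow> v = s))) / q"
      by (intro divide_right_mono parity) simp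
    also have "\<dots> = (\<Sum>u\<in>UNIV. \<Sum>v\<in>UNIV. ?r u * ?r v * ((\<Sum>s\<in>UNIV. ?r s * of_bool (?b \<longleftrightarrow> v = s)) / q))"
      by (simp add: UNIV_bool add_divide_distrib distrib_left)
    also have "\<dots> \<le> (\<Sum>u\<in>UNIV. \<Sum>v\<in>UNIV. ?r u * ?r v * step_mean q p ?lit (?h a u v))"
      by (intro sum_mono mult_left_mono return a mult_nonneg_nonneg r)
    finally show "2 * p * (1 - p) / q \<le> (\<Sum>u\<in>UNIV. \<Sum>v\<in>UNIV. ?r u * ?r v * step_mean q p ?lit (?h a u v))" .
  qed
  also have "\<dots> \<le> (\<Sum>a<q. \<Sum>u\<in>UNIV. \<Sum>v\<in>UNIV. ?r u * ?r v * step_mean q p ?lit (?h a u v))"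
    using p r by (intro sum_mono2 sum_nonneg mult_nonneg_nonneg step_mean_nonneg) auto
  finally have "(real q - 1) * (2 * p * (1 - p) / q) / q \<le> step_mean q p (step_mean q p ?lit) g"
    unfolding step_mean_eq[of q p "step_mean q p ?lit"] by (rule divide_right_mono) simp
  then show ?thesis
    by (simp add: power2_eq_square)
qed

section \<open>The mean length of the random walk\<close>

definition walk_mean :: "nat \<Rightarrow> real \<Rightarrow> nat \<Rightarrow> (lamplighter \<Rightarrow> real) \<Rightarrow> real" where
  "walk_mean q p n F =
    word_mean (sws_generators q) (sws_weight q p) n (\<lambda>ws. F (word_product (lamplighter_group q) ws))"

lemma walk_mean_Suc: "walk_mean q p (Suc n) F = walk_mean q p n (step_mean q p F)"
  by (simp add: walk_mean_def word_mean_Suc[OF finite_sws_generators] step_mean_def)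

lemma walk_mean_mono:
  assumes "0 \<le> p" "p \<le> 1" "\<And>g. g \<in> carrier (lamplighter_group q) \<Longrightarrow> F g \<le> H g"
  shows "walk_mean q p n F \<le> walk_mean q p n H"
proof -
  interpret group "lamplighter_group q" by (rule group_lamplighter_group)
  show ?thesis
    unfolding walk_mean_def using assms word_product_closed[OF sws_generators_carrier]
    by (intro word_mean_mono sws_weight_nonneg) auto
qed

lemma walk_mean_add: "walk_mean q p n (\<lambda>g. F g + H g) = walk_mean q p n F + walk_mean q p n H"
  by (simp add: walk_mean_def word_mean_add)

lemma walk_mean_cmult: "walk_mean q p n (\<lambda>g. c * F g) = c * walk_mean q p n F"
  by (simp add: walk_mean_def word_mean_cmult)

lemma walk_mean_const: "0 < q \<Longrightarrow> walk_mean q p n (\<lambda>_. c) = c"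
  unfolding walk_mean_def by (intro word_mean_const finite_sws_generators sum_sws_weight)

lemma walk_mean_length:
  assumes q: "1 \<le> q" and p: "0 \<le> p" "p \<le> 1"
  shows "real n * ((real q - 2) / q) \<le> walk_mean q p n (\<lambda>g. real (length (snd g)))"
proof (induction n)
  case 0
  show ?case by (simp add: walk_mean_def)
next
  case (Suc n)
  have "real (Suc n) * ((real q - 2) / q) \<le> walk_mean q p n (\<lambda>g. real (length (snd g))) + (real q - 2) / q"
    using Suc by (simp only: of_nat_Suc distrib_right mult_1_left)
  also have "\<dots> = walk_mean q p n (\<lambda>g. real (length (snd g)) + (real q - 2) / q)"
    using q by (simp add: walk_mean_add walk_mean_const)
  also have "\<dots> \<le> walk_mean q p n (step_mean q p (\<lambda>g. real (length (snd g))))"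
    using q p by (intro walk_mean_mono step_mean_length) auto
  finally show ?case
    by (simp add: walk_mean_Suc)
qed

lemma walk_mean_child_lit:
  assumes q: "1 \<le> q" and p: "0 \<le> p" "p \<le> 1"
  shows "(real q - 1) / q\<^sup>2 * (2 * p * (1 - p)) \<le> walk_mean q p (n + 2) (\<lambda>g. of_bool (child_lit g))"
proof -
  have "(real q - 1) / q\<^sup>2 * (2 * p * (1 - p)) = walk_mean q p n (\<lambda>_. (real q - 1) / q\<^sup>2 * (2 * p * (1 - p)))"
    using q by (simp only: walk_mean_const)
  also have "\<dots> \<le> walk_mean q p n (step_mean q p (step_mean q p (\<lambda>g. of_bool (child_lit g))))"
    using q p by (intro walk_mean_mono two_step_child_lit)
  finally show ?thesis
    by (simp add: walk_mean_Suc)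
qed

text \<open>
  The lit children at time \<open>n + 2\<close> are made by the last two steps, so the growth starts two steps late.
\<close>

lemma walk_mean_branch_potential:
  assumes q: "2 \<le> q" and p: "0 \<le> p" "p \<le> 1"
  shows "real n * (escape_prob q 1 * (real q - 2) / q * ((real q - 1) / q\<^sup>2 * (2 * p * (1 - p))))
    \<le> walk_mean q p (n + 2) (branch_potential q)"
proof (induction n)
  case 0
  have "0 = walk_mean q p 2 (\<lambda>_. 0)"
    using q by (simp add: walk_mean_const)
  also have "\<dots> \<le> walk_mean q p 2 (branch_potential q)"
    using p q by (intro walk_mean_mono) (auto simp: branch_potential_def intro!: sum_nonneg escape_prob_nonneg)
  finally show ?case by (simp add: numeral_2_eq_2)
next
  case (Suc n)
  let ?e = "escape_prob q 1 * (real q - 2) / q"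
  have e: "0 \<le> ?e"
    using q escape_prob_nonneg[OF q, of 1] by simp
  have "real (Suc n) * (?e * ((real q - 1) / q\<^sup>2 * (2 * p * (1 - p)))) \<le>
      walk_mean q p (n + 2) (branch_potential q) + ?e * ((real q - 1) / q\<^sup>2 * (2 * p * (1 - p)))"
    using Suc by (simp only: of_nat_Suc distrib_right mult_1_left)
  also have "\<dots> \<le> walk_mean q p (n + 2) (branch_potential q) +
      ?e * walk_mean q p (n + 2) (\<lambda>g. of_bool (child_lit g))"
    using q p e by (intro add_left_mono mult_left_mono walk_mean_child_lit) auto
  also have "\<dots> = walk_mean q p (n + 2) (\<lambda>g. branch_potential q g + ?e * of_bool (child_lit g))"
    by (simp only: walk_mean_add walk_mean_cmult)
  also have "\<dots> \<le> walk_mean q p (n + 2) (step_mean q p (branch_potential q))"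
    using q p by (intro walk_mean_mono step_mean_branch_potential)
  finally show ?case
    by (simp add: walk_mean_Suc)
qed

lemma sws_length_ge:
  assumes q: "2 \<le> q" and ws: "set ws \<subseteq> sws_generators q"
  defines "g \<equiv> word_product (lamplighter_group q) ws"
  shows "real (length (snd g)) + 2 * branch_potential q g \<le> real (sws_length q g)"
proof -
  interpret group "lamplighter_group q" by (rule group_lamplighter_group)
  have "g \<in> carrier (lamplighter_group q)"
    unfolding g_def by (rule word_product_closed[OF sws_generators_carrier ws])
  then have "finite (lamps_on (fst g))"
    by (simp add: lamplighter_carrier configurations_def)
  then have "real (length (snd g)) + 2 * branch_potential q g \<le> excursion_length g"
    using q by (rule branch_potential_le_excursion)
  also have "excursion_length g \<le> int (sws_length q g)"
    unfolding sws_length_def g_def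
    by (rule excursion_length_le_path[OF cayley_length_path[OF sws_generators_carrier ws ws]])
  finally show ?thesis by simp
qed

lemma walk_mean_sws_length:
  assumes q: "3 \<le> q" and p: "0 \<le> p" "p \<le> 1"
    and B: "B = 4 / real q ^ 3 * (real q - 1) * (real q - 2) * p * (1 - p)"
  shows "real n * ((real q - 2) / q * (1 + B)) \<le> walk_mean q p (n + 2) (\<lambda>g. real (sws_length q g))"
proof -
  have e: "escape_prob q 1 = (real q - 2) / (real q - 1)"
    using q by (simp add: escape_prob_def field_simps)
  let ?c = "escape_prob q 1 * (real q - 2) / q * ((real q - 1) / q\<^sup>2 * (2 * p * (1 - p)))"
  have c: "?c = 2 * p * (1 - p) * (real q - 2)\<^sup>2 / q ^ 3"
    using q unfolding e by (simp add: power2_eq_square power3_eq_cube mult_ac)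
  have "(real q - 2) / q * B = 2 * (?c * ((real q - 1) / q))"
    unfolding c B by (simp add: power2_eq_square power3_eq_cube field_simps)
  \<comment> \<open>The bound loses a factor \<open>(q - 1) / q\<close> here.\<close>
  also have "\<dots> \<le> 2 * ?c"
  proof -
    have "0 \<le> ?c"
      unfolding c using p by simp
    moreover have "(real q - 1) / q \<le> 1"
      using q by simp
    ultimately have "?c * ((real q - 1) / q) \<le> ?c * 1"
      by (rule mult_left_mono[rotated])
    then show ?thesis by simp
  qed
  finally have "(real q - 2) / q * (1 + B) \<le> (real q - 2) / q + 2 * ?c"
    by (simp only: distrib_left mult_1_right add_left_mono)
  then have "real n * ((real q - 2) / q * (1 + B)) \<le> real n * ((real q - 2) / q + 2 * ?c)"
    by (rule mult_left_mono) simp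
  also have "\<dots> = real n * ((real q - 2) / q) + 2 * (real n * ?c)"
    by (simp only: distrib_left mult.left_commute[of _ 2])
  also have "\<dots> \<le> real (n + 2) * ((real q - 2) / q) + 2 * (real n * ?c)"
    using q by (intro add_right_mono mult_right_mono) auto
  also have "\<dots> \<le> walk_mean q p (n + 2) (\<lambda>g. real (length (snd g)))
      + 2 * walk_mean q p (n + 2) (branch_potential q)"
    using q p by (intro add_mono mult_left_mono walk_mean_length walk_mean_branch_potential) auto
  also have "\<dots> = walk_mean q p (n + 2) (\<lambda>g. real (length (snd g)) + 2 * branch_potential q g)"
    by (simp only: walk_mean_add walk_mean_cmult)
  also have "\<dots> \<le> walk_mean q p (n + 2) (\<lambda>g. real (sws_length q g))"
    unfolding walk_mean_def using q p by (intro word_mean_mono sws_weight_nonneg sws_length_ge) auto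
  finally show ?thesis .
qed

lemma walk_eq_word_product: "walk G i n \<omega> = word_product G (word (\<lambda>k. i (Suc k)) 0 n \<omega>)"
  by (induction n) (simp_all add: word_def)

theorem theorem5p2:
  fixes q :: nat and p B :: real
    and M :: "'m measure" and i :: "nat \<Rightarrow> 'm \<Rightarrow> lamplighter"
  assumes "q \<ge> 3" and "0 < p" and "p < 1"
    and "prob_space M"
    and "prob_space.indep_vars M (\<lambda>_. count_space (carrier (lamplighter_group q))) i {1..}"
    and "\<And>n. n \<ge> 1 \<Longrightarrow>
           distributed M (count_space (carrier (lamplighter_group q))) (i n)
             (\<lambda>g. ennreal (sws_weight q p g))"
    and "B = 4 / real q ^ 3 * (real q - 1) * (real q - 2) * p * (1 - p)"
  shows "\<exists>l::real.
           (AE \<omega> in M. (\<lambda>n. real (sws_length q (walk (lamplighter_group q) i n \<omega>)) / real n) \<longlonglongrightarrow> l)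
           \<and> l \<ge> (real q - 2) / real q * (1 + B)"
proof -
  let ?L = "lamplighter_group q" and ?S = "sws_generators q" and ?w = "sws_weight q p"
  interpret prob_space M by fact
  interpret L: group ?L by (rule group_lamplighter_group)
  \<comment> \<open>On a null set the increments may fail to be generators; there they are replaced by \<open>s0\<close>.\<close>
  define s0 where "s0 = switch_step 0 False False"
  have s0: "s0 \<in> ?S"
    unfolding s0_def sws_generators_eq using \<open>q \<ge> 3\<close> by (intro image_eqI[of _ _ "(0, False, False)"]) auto
  define X where "X k \<omega> = (if i (Suc k) \<omega> \<in> ?S then i (Suc k) \<omega> else s0)" for k \<omega>
  have i_rv [measurable]: "i (Suc k) \<in> measurable M (count_space (carrier ?L))" for k
    using assms(6)[of "Suc k"] by (auto simp: distributed_def)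
  have generators: "AE \<omega> in M. i (Suc k) \<omega> \<in> ?S" for k
    using distributed_AE2[OF assms(6)[of "Suc k"], of "\<lambda>g. g \<in> ?S"]
    by (auto simp: sws_weight_def AE_count_space)
  have AE_X: "AE \<omega> in M. X k \<omega> = i (Suc k) \<omega>" for k
    using generators[of k] by (rule AE_mp[OF _ AE_I2]) (simp add: X_def)
  interpret subadditive_words M ?S X ?w "\<lambda>ws. real (sws_length q (word_product ?L ws))"
  proof
    show "finite ?S"
      by (rule finite_sws_generators)
    have "indep_vars (\<lambda>_. count_space (carrier ?L)) (\<lambda>k. i (Suc k)) UNIV"
      using assms(5) by (rule indep_vars_Suc)
    then show "indep_vars (\<lambda>_. count_space ?S) X UNIV"
      unfolding X_def[abs_def] by (rule indep_vars_compose2) (use s0 in auto)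
    show "prob {\<omega> \<in> space M. X n \<omega> = s} = ?w s" if s: "s \<in> ?S" for n s
    proof -
      have sL: "s \<in> carrier ?L"
        using s sws_generators_carrier by blast
      have X_rv [measurable]: "X n \<in> measurable M (count_space ?S)"
        using \<open>indep_vars (\<lambda>_. count_space ?S) X UNIV\<close> by (simp add: indep_vars_def)
      have 1: "X n -` {s} \<inter> space M \<in> events" "i (Suc n) -` {s} \<inter> space M \<in> events"
        using s sL by (auto intro!: measurable_sets[OF X_rv] measurable_sets[OF i_rv])
      have "prob (X n -` {s} \<inter> space M) = prob (i (Suc n) -` {s} \<inter> space M)"
        using AE_X[of n] 1 by (intro finite_measure_eq_AE) auto
      also have "emeasure M (i (Suc n) -` {s} \<inter> space M) = ennreal (?w s)"
        using sL by (subst distributed_emeasure[OF assms(6)]) auto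
      then have "prob (i (Suc n) -` {s} \<inter> space M) = ?w s"
        using assms by (simp add: measure_def sws_weight_nonneg)
      finally show ?thesis
        by (simp add: vimage_def Int_def conj_commute)
    qed
  next
    fix xs ys assume xs: "set xs \<subseteq> ?S" and ys: "set ys \<subseteq> ?S"
    note len = L.cayley_length_append[OF sws_generators_carrier xs ys]
      L.cayley_length_suffix[OF sws_generators_carrier xs ys]
    show "real (sws_length q (word_product ?L (xs @ ys)))
        \<le> real (sws_length q (word_product ?L xs)) + real (sws_length q (word_product ?L ys))"
      unfolding sws_length_def using len(1) by linarith
    show "real (sws_length q (word_product ?L ys))
        \<le> real (length xs) + real (sws_length q (word_product ?L (xs @ ys)))"
      unfolding sws_length_def using len(2) by linarith
  next
    fix xs assume xs: "set xs \<subseteq> ?S"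
    show "real (sws_length q (word_product ?L xs)) \<le> real (length xs)"
      unfolding sws_length_def using L.cayley_length_le[OF sws_generators_carrier xs xs] by simp
  qed simp
  have "AE \<omega> in M. \<forall>k. X k \<omega> = i (Suc k) \<omega>"
    unfolding AE_all_countable using AE_X by blast
  then have "AE \<omega> in M. (\<lambda>n. real (sws_length q (walk ?L i n \<omega>)) / real n) \<longlonglongrightarrow> rate"
    using AE_tendsto_rate
  proof eventually_elim
    case (elim \<omega>)
    then show ?case
      by (simp add: walk_eq_word_product word_def)
  qed
  moreover have "(real q - 2) / real q * (1 + B) \<le> rate"
  proof (rule LIMSEQ_le)
    let ?b = "(real q - 2) / real q * (1 + B)"
    show "(\<lambda>n. mean_length (n + 2) / real (n + 2)) \<longlonglongrightarrow> rate"
      by (rule LIMSEQ_ignore_initial_segment[OF mean_length_tendsto])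
    have "(\<lambda>n. real n / real (n + 2)) \<longlonglongrightarrow> 1"
      by real_asymp
    from tendsto_mult_right[OF this, of ?b] show "(\<lambda>n. real n / real (n + 2) * ?b) \<longlonglongrightarrow> ?b"
      by simp
    have "real n / real (n + 2) * ?b \<le> mean_length (n + 2) / real (n + 2)" for n
    proof -
      have "real n * ?b \<le> mean_length (n + 2)"
        using walk_mean_sws_length[of q p B n] assms by (simp add: mean_length_def walk_mean_def)
      then have "real n * ?b / real (n + 2) \<le> mean_length (n + 2) / real (n + 2)"
        by (rule divide_right_mono) simp
      then show ?thesis by (simp only: times_divide_eq_left)
    qed
    then show "\<exists>N. \<forall>n\<ge>N. real n / real (n + 2) * ?b \<le> mean_length (n + 2) / real (n + 2)"
      by blast
  qed
  ultimately show ?thesis by blast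
qed

end
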